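(* For every infinite cardinal $\kappa$ and every natural number $d>1$, $\chi_{\rm CF}(\beth_\omega(\kappa),\kappa,d)=\omega$.
   Context: $\beth_0(\kappa)=\kappa$, $\beth_{n+1}(\kappa)=2^{\beth_n(\kappa)}$, and $\beth_\omega(\kappa)=\sup_{n<\omega}\beth_n(\kappa)$. For a family $\mathcal A$ and cardinal $\rho$, $f:\bigcup\mathcal A\to\rho$ is a conflict free coloring of $\mathcal A$ if every $A\in\mathcal A$ contains exactly one point of some color class $f^{-1}\{\zeta\}$; $\chi_{\rm CF}(\mathcal A)$ is the least such $\rho$. A $(\lambda,\kappa,\mu)$-system is a family of $\lambda$ sets, each of size $\kappa$ (at least two elements), any two distinct of which meet in fewer than $\mu$ points; $\chi_{\rm CF}(\lambda,\kappa,\mu)$ is the supremum of $\chi_{\rm CF}(\mathcal A)$ over all $(\lambda,\kappa,\mu)$-systems $\mathcal A$. *)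

theory Defs
  imports Main
begin

(* beth_ge K n X  <->  beth_n(|K|) \<le> |X|   (cardinal comparison, stays inside one type) *)
fun beth_ge :: "'k set \<Rightarrow> nat \<Rightarrow> 'a set \<Rightarrow> bool" where
  "beth_ge K 0 X = ((card_of K, card_of X) \<in> ordLeq)"
| "beth_ge K (Suc n) X =
     (\<exists>Y. Y \<subseteq> X \<and> beth_ge K n Y \<and> (card_of (Pow Y), card_of X) \<in> ordLeq)"

definition card_is_beth_omega :: "'k set \<Rightarrow> 'a set \<Rightarrow> bool" where
  "card_is_beth_omega K X \<longleftrightarrow>
     (\<forall>n. beth_ge K n X) \<and>
     (\<forall>Y. Y \<subseteq> X \<longrightarrow> (\<forall>n. beth_ge K n Y) \<longrightarrow> (card_of X, card_of Y) \<in> ordLeq)"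

definition beth_omega_system :: "'k set \<Rightarrow> nat \<Rightarrow> 'a set set \<Rightarrow> bool" where
  "beth_omega_system K d \<A> \<longleftrightarrow>
     card_is_beth_omega K \<A> \<and>
     (\<forall>A\<in>\<A>. (card_of A, card_of K) \<in> ordIso \<and> (\<exists>x y. x \<in> A \<and> y \<in> A \<and> x \<noteq> y)) \<and>
     (\<forall>A\<in>\<A>. \<forall>B\<in>\<A>. A \<noteq> B \<longrightarrow> finite (A \<inter> B) \<and> card (A \<inter> B) < d)"

definition cf_coloring :: "'a set set \<Rightarrow> ('a \<Rightarrow> 'c) \<Rightarrow> 'c set \<Rightarrow> bool" where
  "cf_coloring \<A> f C \<longleftrightarrow>
     f ` (\<Union>\<A>) \<subseteq> C \<and> (\<forall>A\<in>\<A>. \<exists>\<zeta>. \<exists>!x. x \<in> A \<and> f x = \<zeta>)"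

end

theory Submission
  imports Defs "HOL-Library.FuncSet"
begin

text \<open>
  Upper bound. By induction on \<open>|X|\<close>, for every \<open>m\<close> some colouring of \<open>X\<close> by natural numbers gives each member
  at least \<open>m\<close> uniquely coloured points. Up to size \<open>|K|\<close> this is a transfinite recursion; above,
  \<open>X\<close> is split along a chain of smaller sets closed under the rule that a member with \<open>d\<close> points
  inside lies inside.

  Lower bound. Suppose every conflict free colouring of a linear system \<open>\<S>\<close> on \<open>Y\<close> with colours below \<open>n\<close> uses
  at least \<open>k\<close> colours. Take copies of \<open>\<S>\<close> indexed by the lists \<open>h\<close> of length \<open>r\<close> with one entry
  deleted. To each \<open>h\<close> attach a set consisting of at most one point from each of its \<open>r\<close> copies and
  of \<open>|K|\<close> fresh points. The entries of \<open>h\<close> encode a guess of the colourings of these copies, and for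
  every colouring some \<open>h\<close> guesses right. For such an \<open>h\<close> the points in the copies can be selected such that
  they repeat each of at least \<open>k\<close> colours; the unique colour of the new set is then a further one.
  After finitely many steps, hence finitely many exponentiations, \<open>n\<close> colours do not suffice.
\<close>

unbundle cardinal_syntax

section \<open>Cardinal arithmetic\<close>

lemma card_of_lists_le:
  assumes "infinite Y"
  shows "|lists Y| \<le>o |Y|"
proof -
  have n: "|{xs. set xs \<subseteq> Y \<and> length xs = n}| \<le>o |Y|" for n
  proof (induction n)
    case 0
    have "{xs. set xs \<subseteq> Y \<and> length xs = 0} = {[]}" by auto
    then show ?case using assms by (metis card_of_singl_ordLeq finite.emptyI)
  next
    case (Suc n)
    have "{xs. set xs \<subseteq> Y \<and> length xs = Suc n}
        \<subseteq> (\<lambda>(x, xs). x # xs) ` (Y \<times> {xs. set xs \<subseteq> Y \<and> length xs = n})"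
      by (auto simp: length_Suc_conv image_iff)
    then have "|{xs. set xs \<subseteq> Y \<and> length xs = Suc n}|
        \<le>o |Y \<times> {xs. set xs \<subseteq> Y \<and> length xs = n}|"
      by (rule surj_imp_ordLeq)
    also have "|Y \<times> {xs. set xs \<subseteq> Y \<and> length xs = n}| \<le>o |Y|"
      using assms Suc by (intro card_of_Sigma_ordLeq_infinite) (auto simp: card_of_refl ordIso_imp_ordLeq)
    finally show ?case .
  qed
  have "lists Y = (\<Union>n\<in>UNIV. {xs. set xs \<subseteq> Y \<and> length xs = n})"
    by (auto simp: lists_eq_set)
  then show ?thesis
    using n assms by (metis (no_types, lifting) card_of_UNION_ordLeq_infinite infinite_iff_card_of_nat)
qed

lemma card_of_Times_le:
  assumes "infinite C" "|A| \<le>o |C|" "|B| \<le>o |C|"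
  shows "|A \<times> B| \<le>o |C|"
  using assms by (intro card_of_Sigma_ordLeq_infinite) auto

lemma card_of_Un_le:
  assumes "infinite C" "|A| \<le>o |C|" "|B| \<le>o |C|"
  shows "|A \<union> B| \<le>o |C|"
  using assms card_of_Un_ordLeq_infinite_Field[of "|C|" A B]
  by (simp add: Field_card_of card_of_card_order_on)

lemma card_of_nat_le: "infinite C \<Longrightarrow> |B :: nat set| \<le>o |C|"
  by (meson card_of_mono1 infinite_iff_card_of_nat ordLeq_transitive subset_UNIV)

lemma finite_card_of_le_infinite:
  assumes "finite A" "infinite B"
  shows "|A| \<le>o |B|"
  using assms card_of_ordLeq_infinite ordLeq_total[OF card_of_Well_order card_of_Well_order] by blast

lemma card_of_finite_subsets_le:
  assumes "infinite X"
  shows "|{S. S \<subseteq> X \<and> finite S}| \<le>o |X|"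
proof -
  have "{S. S \<subseteq> X \<and> finite S} \<subseteq> set ` lists X"
    using finite_list by (fastforce simp: lists_eq_set)
  then have "|{S. S \<subseteq> X \<and> finite S}| \<le>o |lists X|" by (rule surj_imp_ordLeq)
  then show ?thesis by (rule ordLeq_transitive[OF _ card_of_lists_le[OF assms]])
qed

lemma finite_card_of_less_infinite:
  assumes "finite A" "infinite B"
  shows "|A| <o |B|"
  using assms finite_ordLess_infinite[OF card_of_Well_order card_of_Well_order, of A B]
  by (simp add: Field_card_of)

lemma card_of_finite_subsets_less:
  assumes "infinite K" "|Y| <o |K|"
  shows "|{S. S \<subseteq> Y \<and> finite S}| <o |K|"
proof (cases "finite Y")
  case True
  then show ?thesis using assms(1) by (intro finite_card_of_less_infinite) auto
next
  case False
  show ?thesis by (rule ordLeq_ordLess_trans[OF card_of_finite_subsets_le[OF False] assms(2)])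
qed

lemma card_of_UN_finite_less:
  assumes "infinite K" "|I| <o |K|" "\<And>i. i \<in> I \<Longrightarrow> finite (A i)"
  shows "|\<Union>i\<in>I. A i| <o |K|"
proof (cases "finite I")
  case True
  then show ?thesis using assms(1,3) by (intro finite_card_of_less_infinite) auto
next
  case False
  have "|\<Union>i\<in>I. A i| \<le>o |I|"
    using False assms(3) finite_card_of_le_infinite
    by (intro card_of_UNION_ordLeq_infinite ballI ordIso_imp_ordLeq[OF card_of_refl]) auto
  then show ?thesis using assms(2) by (rule ordLeq_ordLess_trans)
qed

lemma card_of_Diff_finite:
  assumes "infinite A" "finite (A \<inter> F)"
  shows "|A - F| =o |A|"
proof -
  have inf: "infinite (A - F)" using assms by (metis Diff_Int2 Diff_infinite_finite Diff_Int_distrib2 Int_commute Diff_Int inf.idem Diff_cancel Un_empty_left)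
  have "|(A - F) \<union> (A \<inter> F)| \<le>o |A - F|"
    using inf assms(2) finite_card_of_le_infinite
    by (intro card_of_Un_le ordIso_imp_ordLeq[OF card_of_refl]) auto
  then have "|A| \<le>o |A - F|" by (simp add: Un_Diff_Int)
  moreover have "|A - F| \<le>o |A|" by (rule card_of_mono1) auto
  ultimately show ?thesis by (simp add: ordIso_iff_ordLeq)
qed

section \<open>Colouring with countably many colours\<close>

lemma finite_well_order_max:
  assumes "well_order_on X r" "finite S" "S \<noteq> {}" "S \<subseteq> X"
  shows "\<exists>x\<in>S. \<forall>y\<in>S. (y, x) \<in> r"
  using assms(2-4)
proof (induction S rule: finite_ne_induct)
  case (singleton x)
  then show ?case using assms(1) by (auto simp: order_on_defs refl_on_def)
next
  case (insert z S)
  then obtain x where x: "x \<in> S" "\<forall>y\<in>S. (y, x) \<in> r" by auto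
  have r: "trans r" "refl_on X r" "total_on X r" using assms(1) by (auto simp: order_on_defs)
  have zX: "(z, z) \<in> r" using r(2) insert.prems by (auto simp: refl_on_def)
  have "(z, x) \<in> r \<or> (x, z) \<in> r" using r insert x(1) zX by (auto simp: total_on_def)
  then show ?case
  proof
    assume "(z, x) \<in> r"
    then show ?thesis using x by auto
  next
    assume "(x, z) \<in> r"
    then have "\<forall>y\<in>S. (y, z) \<in> r" using x(2) r(1) by (meson transE)
    then show ?thesis using zX by auto
  qed
qed

section \<open>Almost disjoint families and members with many points in a given set\<close>

definition almost_disjoint :: "nat \<Rightarrow> 'a set set \<Rightarrow> bool" where
  "almost_disjoint d \<A> \<longleftrightarrow> (\<forall>A\<in>\<A>. \<forall>B\<in>\<A>. A \<noteq> B \<longrightarrow> finite (A \<inter> B) \<and> card (A \<inter> B) < d)"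

text \<open>A finite witness is used because \<open>card\<close> is 0 on infinite sets, so that
  \<open>d \<le> card (A \<inter> Y)\<close> would fail for infinite intersections. The witness also
  serves as a code for \<open>A\<close>.\<close>

definition heavy :: "nat \<Rightarrow> 'a set \<Rightarrow> 'a set \<Rightarrow> bool" where
  "heavy d Y A \<longleftrightarrow> (\<exists>S. S \<subseteq> A \<inter> Y \<and> finite S \<and> card S = d)"

definition has_unique_points :: "('a \<Rightarrow> 'c) \<Rightarrow> nat \<Rightarrow> 'a set \<Rightarrow> bool" where
  "has_unique_points f m A \<longleftrightarrow>
     (\<exists>F. F \<subseteq> A \<and> finite F \<and> m \<le> card F \<and> (\<forall>x\<in>F. \<forall>y\<in>A. f y = f x \<longrightarrow> y = x))"

lemma not_heavy_iff: "\<not> heavy d Y A \<longleftrightarrow> finite (A \<inter> Y) \<and> card (A \<inter> Y) < d"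
proof
  assume h: "\<not> heavy d Y A"
  show "finite (A \<inter> Y) \<and> card (A \<inter> Y) < d"
  proof (rule ccontr)
    assume "\<not> (finite (A \<inter> Y) \<and> card (A \<inter> Y) < d)"
    then have "infinite (A \<inter> Y) \<or> d \<le> card (A \<inter> Y)" by auto
    then obtain S where "S \<subseteq> A \<inter> Y" "finite S" "card S = d"
      by (meson infinite_arbitrarily_large obtain_subset_with_card_n)
    then show False using h unfolding heavy_def by blast
  qed
next
  assume "finite (A \<inter> Y) \<and> card (A \<inter> Y) < d"
  then show "\<not> heavy d Y A"
    unfolding heavy_def by (metis card_mono not_less)
qed

lemma almost_disjoint_eq:
  assumes "almost_disjoint d \<A>" "A \<in> \<A>" "B \<in> \<A>" "heavy d B A"
  shows "A = B"
proof (rule ccontr)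
  assume "A \<noteq> B"
  then have "\<not> heavy d B A" using assms(1-3) by (simp add: almost_disjoint_def not_heavy_iff)
  then show False using assms(4) by simp
qed

text \<open>Members with \<open>d\<close> common points coincide, so choosing \<open>d\<close>
  points of \<open>Y\<close> in each heavy member is injective.\<close>

lemma card_of_heavy_le:
  assumes "almost_disjoint d \<A>"
  shows "|{A \<in> \<A>. heavy d Y A}| \<le>o |{S. S \<subseteq> Y \<and> finite S}|"
proof -
  have "\<forall>A\<in>{A \<in> \<A>. heavy d Y A}. \<exists>S. S \<subseteq> A \<inter> Y \<and> finite S \<and> card S = d"
    by (simp add: heavy_def)
  then obtain S where S: "\<And>A. A \<in> \<A> \<Longrightarrow> heavy d Y A \<Longrightarrow> S A \<subseteq> A \<inter> Y \<and> finite (S A) \<and> card (S A) = d"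
    by (metis (mono_tags, lifting) mem_Collect_eq)
  show ?thesis
  proof (rule card_of_ordLeqI)
    show "inj_on S {A \<in> \<A>. heavy d Y A}"
    proof (rule inj_onI)
      fix A B assume AB: "A \<in> {A \<in> \<A>. heavy d Y A}" "B \<in> {A \<in> \<A>. heavy d Y A}" "S A = S B"
      then have "S A \<subseteq> A \<inter> B" "finite (S A)" "card (S A) = d" using S[of A] S[of B] by auto
      then have "heavy d B A" unfolding heavy_def by blast
      then show "A = B" using almost_disjoint_eq[OF assms] AB by auto
    qed
  qed (use S in auto)
qed

text \<open>Along a well-order of \<open>\<A>\<close> of length at most \<open>|K|\<close>, each \<open>A\<close> receives a batch of \<open>m\<close> new points with new
  colours; all other points keep colour 0. A batch avoids every earlier member and every member
  that already holds \<open>d\<close> coloured points, so \<open>A\<close> meets only finitely many earlier batches, and no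
  batch chosen after that of \<open>A\<close> meets \<open>A\<close>.\<close>

lemma unique_points_small_family:
  fixes \<A> :: "'a set set" and K :: "'k set"
  assumes K: "infinite K" and \<A>: "|\<A>| \<le>o |K|" "\<And>A. A \<in> \<A> \<Longrightarrow> |A| =o |K|"
    and ad: "almost_disjoint d \<A>"
  shows "\<exists>f :: 'a \<Rightarrow> nat. \<forall>A\<in>\<A>. has_unique_points f m A"
proof -
  define r where "r = |\<A>|"
  have wo: "well_order_on \<A> r" by (simp add: r_def card_of_well_order_on)
  have r: "trans r" "total_on \<A> r" "r \<subseteq> \<A> \<times> \<A>" "wf (r - Id)"
    using wo by (auto simp: order_on_defs well_order_on_def)
  define E where "E A = underS r A" for A
  have E_iff: "B \<in> E A \<longleftrightarrow> (B, A) \<in> r - Id" for A B by (auto simp: E_def underS_def)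
  have E\<A>: "E A \<subseteq> \<A>" for A using r(3) by (auto simp: E_iff)
  have E_total: "B \<in> E A \<or> A = B \<or> A \<in> E B" if "A \<in> \<A>" "B \<in> \<A>" for A B
    using r(2) that by (auto simp: E_iff total_on_def)
  define P where "P h A b \<longleftrightarrow> (A \<in> \<A> \<longrightarrow> fst b \<subseteq> A \<and> finite (fst b) \<and> card (fst b) = m \<and> inj_on (snd b) (fst b)
     \<and> (\<forall>x\<in>fst b. 0 < snd b x \<and> (\<forall>B\<in>E A. x \<notin> B \<and> (\<forall>y\<in>fst (h B) \<inter> A. snd (h B) y \<noteq> snd b x)))
     \<and> (\<forall>B\<in>\<A>. B \<noteq> A \<longrightarrow> heavy d (\<Union>C\<in>E A. fst (h C)) B \<longrightarrow> fst b \<inter> B = {}))"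
    for h :: "'a set \<Rightarrow> 'a set \<times> ('a \<Rightarrow> nat)" and A b
  have "\<exists>h. \<forall>A. P h A (h A)"
  proof (rule dependent_wf_choice[OF r(4)])
    fix f g :: "'a set \<Rightarrow> 'a set \<times> ('a \<Rightarrow> nat)" and A b
    assume "\<And>z. (z, A) \<in> r - Id \<Longrightarrow> f z = g z"
    then have "\<And>C. C \<in> E A \<Longrightarrow> f C = g C" by (simp add: E_iff)
    then show "P f A b = P g A b" unfolding P_def by (simp cong: SUP_cong)
  next
    fix A and h :: "'a set \<Rightarrow> 'a set \<times> ('a \<Rightarrow> nat)"
    assume "\<And>B. (B, A) \<in> r - Id \<Longrightarrow> P h B (h B)"
    then have "P h B (h B)" if "B \<in> E A" for B using that by (simp add: E_iff)
    then have hP: "P h B (h B)" "B \<in> \<A>" if "B \<in> E A" for B using that E\<A>[of A] by auto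
    have h: "fst (h B) \<subseteq> B" "finite (fst (h B))"
       "C \<in> E B \<Longrightarrow> fst (h B) \<inter> C = {}"
       "C \<in> \<A> \<Longrightarrow> C \<noteq> B \<Longrightarrow> heavy d (\<Union>C\<in>E B. fst (h C)) C \<Longrightarrow> fst (h B) \<inter> C = {}"
       if "B \<in> E A" for B C
      using hP[OF that] by (auto simp: P_def)
    show "\<exists>b. P h A b"
    proof (cases "A \<in> \<A>")
      case False
      then show ?thesis by (simp add: P_def)
    next
      case A: True
      define Y where "Y = (\<Union>C\<in>E A. fst (h C))"
      define Q where "Q = {C \<in> E A. fst (h C) \<inter> A \<noteq> {}}"
      define Bad where "Bad = {B \<in> \<A> - {A}. heavy d Y B}"
      have disj: "fst (h B) \<inter> fst (h C) = {}" if BC: "B \<in> E A" "C \<in> E A" "B \<noteq> C" for B C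
        using E_total[OF hP(2)[OF BC(1)] hP(2)[OF BC(2)]]
      proof (elim disjE)
        assume "B \<in> E C"
        then show ?thesis using h(3)[OF BC(2)] h(1)[OF BC(1)] by blast
      next
        assume "C \<in> E B"
        then show ?thesis using h(3)[OF BC(1)] h(1)[OF BC(2)] by blast
      qed (use BC(3) in simp)
      \<comment> \<open>Suppose \<open>d + 1\<close> earlier batches meet \<open>A\<close>, the
        latest being that of \<open>C\<close>. The other \<open>d\<close>, being disjoint, already
        give \<open>A\<close> \<open>d\<close> coloured points when \<open>C\<close> is treated, so
        the batch of \<open>C\<close> must avoid \<open>A\<close>.\<close>
      have finQ: "finite Q"
      proof (rule ccontr)
        assume "infinite Q"
        then obtain T where T: "finite T" "card T = Suc d" "T \<subseteq> Q"
          using infinite_arbitrarily_large by blast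
        have T\<A>: "T \<subseteq> \<A>" using T(3) E\<A>[of A] by (auto simp: Q_def)
        have "T \<noteq> {}" using T(2) by auto
        then obtain C where C: "C \<in> T" "\<forall>D\<in>T. (D, C) \<in> r"
          using finite_well_order_max[OF wo T(1) _ T\<A>] by blast
        have "\<forall>D\<in>T. \<exists>x. x \<in> fst (h D) \<inter> A" using T(3) by (auto simp: Q_def)
        then obtain x where x: "\<And>D. D \<in> T \<Longrightarrow> x D \<in> fst (h D) \<inter> A" by metis
        have "inj_on x T"
        proof (rule inj_onI)
          fix D D' assume D: "D \<in> T" "D' \<in> T" "x D = x D'"
          have "D \<in> E A" "D' \<in> E A" using D(1,2) T(3) by (auto simp: Q_def)
          then show "D = D'" using disj[of D D'] x[OF D(1)] x[OF D(2)] D(3) by auto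
        qed
        then have "card (x ` (T - {C})) = d"
          using T C(1) by (simp add: card_image inj_on_diff)
        moreover have "T - {C} \<subseteq> E C" using C(2) by (auto simp: E_iff)
        then have "x ` (T - {C}) \<subseteq> A \<inter> (\<Union>D\<in>E C. fst (h D))" using x by auto
        ultimately have "heavy d (\<Union>D\<in>E C. fst (h D)) A"
          using T(1) unfolding heavy_def by (intro exI[of _ "x ` (T - {C})"]) simp
        moreover have CE: "C \<in> E A" using C(1) T(3) by (auto simp: Q_def)
        moreover have "A \<noteq> C" using CE by (auto simp: E_iff)
        ultimately have "fst (h C) \<inter> A = {}" using h(4)[of C A] A by blast
        then show False using x[OF C(1)] by blast
      qed
      have EK: "|E A| <o |K|"
      proof -
        have "|E A| <o |\<A>|"
          unfolding E_def r_def using A by (intro card_of_underS) (simp_all add: Field_card_of card_of_card_order_on)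
        then show ?thesis by (rule ordLess_ordLeq_trans[OF _ \<A>(1)])
      qed
      have YK: "|Y| <o |K|"
        unfolding Y_def using h(2) by (intro card_of_UN_finite_less[OF K EK]) auto
      have BadK: "|Bad| <o |K|"
      proof -
        have "|Bad| \<le>o |{B \<in> \<A>. heavy d Y B}|" unfolding Bad_def by (rule card_of_mono1) auto
        then have "|Bad| \<le>o |{S. S \<subseteq> Y \<and> finite S}|"
          by (rule ordLeq_transitive[OF _ card_of_heavy_le[OF ad]])
        then show ?thesis using card_of_finite_subsets_less[OF K YK] by (rule ordLeq_ordLess_trans)
      qed
      \<comment> \<open>\<open>Z\<close> collects the forbidden points of \<open>A\<close>. Fewer
        than \<open>|K|\<close> members contribute, each only finitely many points, so infinitely
        many points of \<open>A\<close> remain.\<close>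
      define Z where "Z = (\<Union>B\<in>E A \<union> Bad. B \<inter> A)"
      have "|E A \<union> Bad| <o |K|" using K EK BadK by (rule card_of_Un_ordLess_infinite)
      moreover have "finite (B \<inter> A)" if "B \<in> E A \<union> Bad" for B
      proof -
        have "B \<in> \<A>" "B \<noteq> A" using that E\<A>[of A] by (auto simp: Bad_def E_iff)
        then show ?thesis using ad A by (simp add: almost_disjoint_def)
      qed
      ultimately have ZK: "|Z| <o |K|" unfolding Z_def by (intro card_of_UN_finite_less[OF K]) auto
      have "infinite (A - Z)"
      proof
        assume fin: "finite (A - Z)"
        have "|(A - Z) \<union> Z| <o |K|"
          using K finite_card_of_less_infinite[OF fin K] ZK by (rule card_of_Un_ordLess_infinite)
        moreover have "|A| \<le>o |(A - Z) \<union> Z|" by (rule card_of_mono1) auto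
        ultimately have "|A| <o |K|" by (rule ordLeq_ordLess_trans[rotated])
        then show False using \<A>(2)[OF A] not_ordLess_ordIso by auto
      qed
      then obtain F where F: "finite F" "card F = m" "F \<subseteq> A - Z"
        using infinite_arbitrarily_large by blast
      \<comment> \<open>Only the finitely many batches of members of \<open>Q\<close> have put
        colours on \<open>A\<close>, so new colours exist; 0 is reserved for points outside all
        batches.\<close>
      define U where "U = insert 0 (\<Union>C\<in>Q. snd (h C) ` fst (h C))"
      have "finite U" using finQ h(2) by (auto simp: U_def Q_def)
      then have "infinite (UNIV - U)" by simp
      then obtain N where N: "finite N" "card N = m" "N \<subseteq> UNIV - U"
        using infinite_arbitrarily_large by blast
      obtain c where c: "bij_betw c F N" using finite_same_card_bij F(1,2) N(1,2) by metis
      have cU: "c x \<notin> U" if "x \<in> F" for x using c N(3) that by (auto simp: bij_betw_def)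
      have "P h A (F, c)"
        unfolding P_def fst_conv snd_conv
      proof (intro impI conjI ballI)
        show "F \<subseteq> A" "finite F" "card F = m" "inj_on c F" using F c by (auto simp: bij_betw_def)
      next
        fix x assume x: "x \<in> F"
        show "0 < c x" using cU[OF x] by (auto simp: U_def)
        fix B assume B: "B \<in> E A"
        show "x \<notin> B" using x F(3) B by (auto simp: Z_def)
        fix y assume y: "y \<in> fst (h B) \<inter> A"
        then have "snd (h B) y \<in> U" using B by (auto simp: U_def Q_def)
        then show "snd (h B) y \<noteq> c x" using cU[OF x] by auto
      next
        fix B assume "B \<in> \<A>" "B \<noteq> A" "heavy d (\<Union>C\<in>E A. fst (h C)) B"
        then have "B \<in> Bad" by (simp add: Bad_def Y_def)
        then show "F \<inter> B = {}" using F(3) by (auto simp: Z_def)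
      qed
      then show ?thesis by blast
    qed
  qed
  then obtain h where hP: "\<And>A. P h A (h A)" by blast
  have h: "fst (h A) \<subseteq> A" "finite (fst (h A))" "card (fst (h A)) = m" "inj_on (snd (h A)) (fst (h A))"
     if "A \<in> \<A>" for A
    using hP[of A] that by (auto simp: P_def)
  have hpos: "0 < snd (h A) x" if "A \<in> \<A>" "x \<in> fst (h A)" for A x
    using hP[of A] that by (auto simp: P_def)
  have hE: "x \<notin> B" "y \<in> fst (h B) \<Longrightarrow> y \<in> A \<Longrightarrow> snd (h B) y \<noteq> snd (h A) x"
    if "A \<in> \<A>" "x \<in> fst (h A)" "B \<in> E A" for A B x y
    using hP[of A] that by (auto simp: P_def)
  have disj: "A = B" if AB: "A \<in> \<A>" "B \<in> \<A>" "x \<in> fst (h A)" "x \<in> fst (h B)" for A B x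
    using E_total[OF AB(1,2)] hE(1)[OF AB(1,3), of B] hE(1)[OF AB(2,4), of A] h(1)[OF AB(1)] h(1)[OF AB(2)] AB(3,4)
    by auto
  define f where "f x = (if \<exists>C\<in>\<A>. x \<in> fst (h C) then snd (h (THE C. C \<in> \<A> \<and> x \<in> fst (h C))) x else 0)" for x
  have f: "f x = snd (h C) x" if C: "C \<in> \<A>" "x \<in> fst (h C)" for x C
  proof -
    have "(THE C. C \<in> \<A> \<and> x \<in> fst (h C)) = C" using C disj by (intro the_equality) blast+
    then show ?thesis using C by (auto simp: f_def)
  qed
  have "has_unique_points f m A" if A: "A \<in> \<A>" for A
    unfolding has_unique_points_def
  proof (intro exI[of _ "fst (h A)"] conjI ballI impI)
    fix x y assume x: "x \<in> fst (h A)" and y: "y \<in> A" and eq: "f y = f x"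
    have "f y > 0" using eq f[OF A x] hpos[OF A x] by simp
    then obtain C where C: "C \<in> \<A>" "y \<in> fst (h C)" by (auto simp: f_def split: if_splits)
    \<comment> \<open>The batch of \<open>A\<close> was given colours different from those of
      earlier batches on \<open>A\<close>; a later batch avoids \<open>A\<close> altogether.\<close>
    from E_total[OF A C(1)] consider "A = C" | "C \<in> E A" | "A \<in> E C" by blast
    then show "y = x"
    proof cases
      case 1
      then show ?thesis using h(4)[OF A] f[OF C] f[OF A x] eq x C(2) by (auto simp: inj_on_def)
    next
      case 2
      then show ?thesis using hE(2)[OF A x 2 C(2) y] f[OF C] f[OF A x] eq by simp
    next
      case 3
      then show ?thesis using hE(1)[OF C 3] y by simp
    qed
  qed (use h[OF A] in auto)
  then show ?thesis by blast
qed

section \<open>Hulls closed under members with \<open>d\<close> points inside\<close>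

primrec grow :: "nat \<Rightarrow> 'a set set \<Rightarrow> 'a set \<Rightarrow> nat \<Rightarrow> 'a set" where
  "grow d \<A> S 0 = S"
| "grow d \<A> S (Suc n) = grow d \<A> S n \<union> \<Union>{A \<in> \<A>. heavy d (grow d \<A> S n) A}"

definition hull :: "nat \<Rightarrow> 'a set set \<Rightarrow> 'a set \<Rightarrow> 'a set" where
  "hull d \<A> S = (\<Union>n. grow d \<A> S n)"

lemma heavy_mono: "heavy d Y A \<Longrightarrow> Y \<subseteq> Y' \<Longrightarrow> heavy d Y' A"
  unfolding heavy_def by blast

lemma finite_subset_chain_UN:
  fixes V :: "'b \<Rightarrow> 'a set"
  assumes "well_order_on X r" "finite S" "S \<noteq> {}" "J \<subseteq> X" "S \<subseteq> (\<Union>x\<in>J. V x)"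
    and mono: "\<And>x y. (x, y) \<in> r \<Longrightarrow> V x \<subseteq> V y"
  shows "\<exists>x\<in>J. S \<subseteq> V x"
proof -
  have "\<forall>s\<in>S. \<exists>x. x \<in> J \<and> s \<in> V x" using assms(5) by auto
  then obtain t where t: "\<And>s. s \<in> S \<Longrightarrow> t s \<in> J \<and> s \<in> V (t s)" by metis
  have "finite (t ` S)" "t ` S \<noteq> {}" "t ` S \<subseteq> X" using assms(2-4) t by auto
  from finite_well_order_max[OF assms(1) this]
  obtain x where x: "x \<in> t ` S" "\<And>y. y \<in> t ` S \<Longrightarrow> (y, x) \<in> r" by blast
  have "S \<subseteq> V x"
  proof
    fix s assume s: "s \<in> S"
    then have "(t s, x) \<in> r" using x(2) by simp
    from mono[OF this] show "s \<in> V x" using t[OF s] by auto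
  qed
  moreover have "x \<in> J" using x(1) t by auto
  ultimately show ?thesis by blast
qed

lemma subset_hull: "S \<subseteq> hull d \<A> S"
  unfolding hull_def by (metis UN_upper UNIV_I grow.simps(1))

lemma hull_mono:
  assumes "S \<subseteq> T"
  shows "hull d \<A> S \<subseteq> hull d \<A> T"
proof -
  have "grow d \<A> S n \<subseteq> grow d \<A> T n" for n
  proof (induction n)
    case (Suc n)
    then show ?case using heavy_mono[of d "grow d \<A> S n"] by fastforce
  qed (use assms in simp)
  then show ?thesis unfolding hull_def by blast
qed

text \<open>The \<open>d\<close> witnessing points all appear by some finite stage, and the next
  stage absorbs \<open>A\<close>; hence countably many stages give closure.\<close>

lemma heavy_hull_subset:
  assumes "A \<in> \<A>" "heavy d (hull d \<A> S) A" "0 < d"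
  shows "A \<subseteq> hull d \<A> S"
proof -
  obtain F where F: "F \<subseteq> A" "F \<subseteq> hull d \<A> S" "finite F" "card F = d"
    using assms(2) by (auto simp: heavy_def)
  have mono: "grow d \<A> S i \<subseteq> grow d \<A> S j" if "i \<le> j" for i j
    using that by (rule lift_Suc_mono_le[rotated]) simp
  have "\<forall>x\<in>F. \<exists>n. x \<in> grow d \<A> S n" using F(2) by (auto simp: hull_def)
  then obtain n where n: "\<And>x. x \<in> F \<Longrightarrow> x \<in> grow d \<A> S (n x)" by metis
  have "F \<subseteq> grow d \<A> S (Max (n ` F))"
  proof
    fix x assume "x \<in> F"
    then show "x \<in> grow d \<A> S (Max (n ` F))"
      using n mono[of "n x" "Max (n ` F)"] F(3) by (auto simp: subset_iff)
  qed
  then have "heavy d (grow d \<A> S (Max (n ` F))) A"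
    using F unfolding heavy_def by blast
  then have "A \<subseteq> grow d \<A> S (Suc (Max (n ` F)))" using assms(1) by auto
  then show ?thesis unfolding hull_def by blast
qed

lemma hull_subset:
  assumes "S \<subseteq> X" "\<And>A. A \<in> \<A> \<Longrightarrow> A \<subseteq> X"
  shows "hull d \<A> S \<subseteq> X"
proof -
  have "grow d \<A> S n \<subseteq> X" for n
    by (induction n) (use assms in auto)
  then show ?thesis unfolding hull_def by blast
qed

text \<open>By \<open>card_of_heavy_le\<close> a stage of size at most \<open>|B|\<close> absorbs at
  most \<open>|B|\<close> members, each of size at most \<open>|B|\<close>, and there are countably
  many stages.\<close>

lemma card_of_hull_le:
  assumes B: "infinite B" and S: "|S| \<le>o |B|" and \<A>: "\<And>A. A \<in> \<A> \<Longrightarrow> |A| \<le>o |B|"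
    and ad: "almost_disjoint d \<A>"
  shows "|hull d \<A> S| \<le>o |B|"
proof -
  have "|grow d \<A> S n| \<le>o |B|" for n
  proof (induction n)
    case (Suc n)
    define Y where "Y = grow d \<A> S n"
    have fin: "|{S. S \<subseteq> Y \<and> finite S}| \<le>o |B|"
    proof (cases "finite Y")
      case True
      then show ?thesis using B by (intro finite_card_of_le_infinite) auto
    next
      case False
      from ordLeq_transitive[OF card_of_finite_subsets_le[OF False]] show ?thesis
        using Suc Y_def by simp
    qed
    have "|\<Union>A\<in>{A \<in> \<A>. heavy d Y A}. A| \<le>o |B|"
      using \<A> by (intro card_of_UNION_ordLeq_infinite B ordLeq_transitive[OF card_of_heavy_le[OF ad] fin]) auto
    then show ?case using Suc B by (simp add: Y_def card_of_Un_le)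
  qed (use S in simp)
  then show ?thesis
    unfolding hull_def using B by (intro card_of_UNION_ordLeq_infinite card_of_nat_le) auto
qed

text \<open>A unique point of \<open>A - Z\<close> is spoiled only if its colour recurs on
  \<open>A \<inter> Z\<close>. Unique points have distinct colours, so fewer than \<open>d\<close>
  of the \<open>m + d\<close> are spoiled.\<close>

lemma has_unique_points_extend:
  assumes "has_unique_points g (m + d) (A - Z)" "finite (A \<inter> Z)" "card (A \<inter> Z) < d"
    and fg: "\<And>x. x \<in> A - Z \<Longrightarrow> f x = g x"
  shows "has_unique_points f m A"
proof -
  obtain F where F: "F \<subseteq> A - Z" "finite F" "m + d \<le> card F"
    "\<And>x y. x \<in> F \<Longrightarrow> y \<in> A - Z \<Longrightarrow> g y = g x \<Longrightarrow> y = x"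
    using assms(1) by (auto simp: has_unique_points_def)
  have uniq: "y = x" if "x \<in> F" "y \<in> A - Z" "f y = f x" for x y
    using F(4)[OF that(1,2)] fg[OF that(2)] fg[of x] F(1) that by auto
  define Bad where "Bad = {x \<in> F. f x \<in> f ` (A \<inter> Z)}"
  have "inj_on f Bad" using uniq F(1) unfolding Bad_def inj_on_def by blast
  moreover have "f ` Bad \<subseteq> f ` (A \<inter> Z)" by (auto simp: Bad_def)
  ultimately have "card Bad \<le> card (f ` (A \<inter> Z))"
    using assms(2) by (intro card_inj_on_le[of f]) auto
  also have "\<dots> \<le> card (A \<inter> Z)" using assms(2) by (rule card_image_le)
  finally have "card Bad < d" using assms(3) by simp
  moreover have "card (F - Bad) = card F - card Bad"
    using F(2) by (intro card_Diff_subset) (auto simp: Bad_def)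
  ultimately have "m \<le> card (F - Bad)" using F(3) by simp
  moreover have "y = x" if x: "x \<in> F - Bad" and y: "y \<in> A" and eq: "f y = f x" for x y
  proof (cases "y \<in> Z")
    case True
    then have "f x \<in> f ` (A \<inter> Z)" using y eq by (metis IntI imageI)
    then show ?thesis using x by (simp add: Bad_def)
  next
    case False
    then show ?thesis using uniq[of x y] x y eq by simp
  qed
  ultimately show ?thesis
    unfolding has_unique_points_def using F(1,2)
    by (intro exI[of _ "F - Bad"]) auto
qed

text \<open>If \<open>|X| > |K|\<close>, then \<open>X\<close> is the union of an increasing chain of hulls \<open>V x\<close> of size less than \<open>|X|\<close>.
  For the first hull \<open>V x\<close> containing \<open>A\<close>, the set \<open>A\<close> has fewer than \<open>d\<close> points in the union \<open>Z x\<close> of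
  the earlier ones, so these points spoil fewer than \<open>d\<close> of the unique colours that induction
  gives on \<open>V x - Z x\<close>. This is why the number \<open>m\<close> of unique points varies in the induction.\<close>

lemma unique_points_colouring:
  fixes \<A> :: "'a set set" and X :: "'a set" and K :: "'k set"
  assumes K: "infinite K" and d: "0 < d"
    and "\<And>A. A \<in> \<A> \<Longrightarrow> A \<subseteq> X \<and> |A| =o |K|" and "almost_disjoint d \<A>"
  shows "\<exists>f :: 'a \<Rightarrow> nat. \<forall>A\<in>\<A>. has_unique_points f m A"
  using assms(3,4)
proof (induction X arbitrary: \<A> m rule: wf_induct_rule[OF wf_inv_image[OF wf_ordLess, of card_of]])
  case (1 X \<A> m)
  have IH: "\<exists>f :: 'a \<Rightarrow> nat. \<forall>A\<in>\<A>'. has_unique_points f m' A"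
    if "|X'| <o |X|" "\<And>A. A \<in> \<A>' \<Longrightarrow> A \<subseteq> X' \<and> |A| =o |K|" "almost_disjoint d \<A>'" for X' \<A>' m'
    using "1.IH"[of X' \<A>' m'] that by (simp add: in_inv_image)
  have AX: "A \<subseteq> X" "|A| =o |K|" if "A \<in> \<A>" for A using "1.prems"(1) that by auto
  have infA: "infinite A" if "A \<in> \<A>" for A using AX(2)[OF that] card_of_ordIso_finite K by blast
  note ad = "1.prems"(2)
  \<comment> \<open>Members are infinite subsets of \<open>X\<close>, so the bound on heavy members
    becomes a bound on all of \<open>\<A>\<close>.\<close>
  have all_heavy: "{A \<in> \<A>. heavy d X A} = \<A>"
  proof -
    have "heavy d X A" if "A \<in> \<A>" for A
      using infA[OF that] AX(1)[OF that] not_heavy_iff[of d X A] by (auto simp: Int_absorb2)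
    then show ?thesis by auto
  qed
  show ?case
  proof (cases "|X| \<le>o |K|")
    case True
    have "|\<A>| \<le>o |K|"
    proof (cases "\<A> = {}")
      case False
      then have "infinite X" using infA AX(1) finite_subset by blast
      then have "|{S. S \<subseteq> X \<and> finite S}| \<le>o |K|"
        using card_of_finite_subsets_le ordLeq_transitive True by blast
      with card_of_heavy_le[OF ad, of X] show ?thesis
        unfolding all_heavy by (rule ordLeq_transitive)
    qed (simp add: card_of_empty)
    then show ?thesis using unique_points_small_family[OF K _ AX(2) ad] by blast
  next
    case False
    then have KX: "|K| <o |X|" by (simp add: not_ordLeq_iff_ordLess card_of_Well_order)
    \<comment> \<open>A well-order of least type: its proper initial segments are smaller than
      \<open>X\<close>.\<close>
    define r where "r = |X|"
    have wo: "well_order_on X r" by (simp add: r_def card_of_well_order_on)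
    have r: "trans r" "antisym r" "refl_on X r" "total_on X r" "r \<subseteq> X \<times> X" "wf (r - Id)"
      using wo by (auto simp: order_on_defs well_order_on_def)
    have infX: "infinite X"
      using K KX card_of_ordLeq_infinite ordLess_imp_ordLeq by blast
    have underX: "underS r x \<subseteq> X" for x using r(5) by (auto simp: underS_def)
    have mono: "insert x (underS r x) \<subseteq> insert y (underS r y)" if "(x, y) \<in> r" for x y
    proof
      fix z assume "z \<in> insert x (underS r x)"
      then have "(z, x) \<in> r \<or> z = x" by (auto simp: underS_def)
      then have "(z, y) \<in> r" using that r(1) by (metis transE)
      then show "z \<in> insert y (underS r y)" by (auto simp: underS_def)
    qed
    define V where "V x = hull d \<A> (insert x (underS r x))" for x
    define Z where "Z x = (\<Union>y\<in>underS r x. V y)" for x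
    have V_mono: "V x \<subseteq> V y" if "(x, y) \<in> r" for x y
      unfolding V_def by (rule hull_mono[OF mono[OF that]])
    have V_self: "x \<in> V x" for x
      using subset_hull[of "insert x (underS r x)" d \<A>] by (simp add: V_def)
    have VX: "V x \<subseteq> X" if "x \<in> X" for x
      unfolding V_def using that underX[of x] AX(1) by (intro hull_subset) auto
    have V_less: "|V x| <o |X|" if "x \<in> X" for x
    proof -
      \<comment> \<open>The disjoint sum dominates both the initial segment and the members, and it
        is still smaller than \<open>X\<close>.\<close>
      define B where "B = underS r x <+> K"
      have "|underS r x| <o |X|"
        unfolding r_def using that by (intro card_of_underS) (simp_all add: Field_card_of card_of_card_order_on)
      then have "|B| <o |X|" unfolding B_def using infX KX by (intro card_of_Plus_ordLess_infinite)
      moreover have "|V x| \<le>o |B|"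
        unfolding V_def
      proof (rule card_of_hull_le[OF _ _ _ ad])
        show infB: "infinite B" using K by (simp add: B_def)
        show "|insert x (underS r x)| \<le>o |B|"
          using card_of_Un_le[OF infB finite_card_of_le_infinite[of "{x}", OF _ infB], of "underS r x"]
            card_of_Plus1[of "underS r x" K] by (simp add: B_def)
        fix A assume "A \<in> \<A>"
        then show "|A| \<le>o |B|" unfolding B_def by (rule ordIso_ordLeq_trans[OF AX(2) card_of_Plus2])
      qed
      ultimately show ?thesis by (rule ordLeq_ordLess_trans[rotated])
    qed
    have sub_V: "A \<subseteq> V x" if "A \<in> \<A>" "heavy d (V x) A" for A x
      using heavy_hull_subset[OF that(1) _ d] that(2) by (simp add: V_def)
    define W where "W x = V x - Z x" for x
    \<comment> \<open>The induction hypothesis is applied to traces on \<open>W x\<close>. Fewer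
      than \<open>d\<close> points are removed from each member, so the traces keep size
      \<open>|K|\<close>.\<close>
    define \<B> where "\<B> x = (\<lambda>A. A - Z x) ` {A \<in> \<A>. A \<subseteq> V x \<and> \<not> heavy d (Z x) A}" for x
    have "\<exists>g :: 'a \<Rightarrow> nat. \<forall>A\<in>\<B> x. has_unique_points g (m + d) A" if "x \<in> X" for x
    proof (rule IH[of "W x"])
      show "|W x| <o |X|"
        by (rule ordLeq_ordLess_trans[OF card_of_mono1 V_less[OF that]]) (auto simp: W_def)
    next
      fix B assume "B \<in> \<B> x"
      then obtain A where A: "A \<in> \<A>" "A \<subseteq> V x" "\<not> heavy d (Z x) A" "B = A - Z x" by (auto simp: \<B>_def)
      have "|B| =o |A|" using A(3,4) infA[OF A(1)] by (simp add: not_heavy_iff card_of_Diff_finite)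
      then show "B \<subseteq> W x \<and> |B| =o |K|"
        using A AX(2)[OF A(1)] ordIso_transitive by (auto simp: W_def)
    next
      show "almost_disjoint d (\<B> x)"
        unfolding almost_disjoint_def
      proof (intro ballI impI)
        fix B C assume "B \<in> \<B> x" "C \<in> \<B> x" "B \<noteq> C"
        then obtain A A' where A: "A \<in> \<A>" "A' \<in> \<A>" "A \<noteq> A'" "B = A - Z x" "C = A' - Z x"
          by (auto simp: \<B>_def)
        have fin: "finite (A \<inter> A')" "card (A \<inter> A') < d" using ad A(1-3) by (auto simp: almost_disjoint_def)
        have "B \<inter> C \<subseteq> A \<inter> A'" using A(4,5) by auto
        then show "finite (B \<inter> C) \<and> card (B \<inter> C) < d"
          using fin card_mono[OF fin(1), of "B \<inter> C"] finite_subset[OF _ fin(1), of "B \<inter> C"] by simp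
      qed
    qed
    then obtain g :: "'a \<Rightarrow> 'a \<Rightarrow> nat"
      where g: "\<And>x B. x \<in> X \<Longrightarrow> B \<in> \<B> x \<Longrightarrow> has_unique_points (g x) (m + d) B" by metis
    have W_disj: "x = y" if "x \<in> X" "y \<in> X" "z \<in> W x" "z \<in> W y" for x y z
    proof (rule ccontr)
      assume "x \<noteq> y"
      then have "x \<in> underS r y \<or> y \<in> underS r x"
        using r(4) that(1,2) by (auto simp: total_on_def underS_def)
      then show False using that(3,4) by (auto simp: W_def Z_def)
    qed
    \<comment> \<open>The layers \<open>W x\<close> are pairwise disjoint, so the colourings
      \<open>g x\<close> glue together.\<close>
    define f where "f z = g (THE x. x \<in> X \<and> z \<in> W x) z" for z
    have f: "f z = g x z" if "x \<in> X" "z \<in> W x" for x z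
    proof -
      have "(THE x. x \<in> X \<and> z \<in> W x) = x" using that W_disj by (intro the_equality) blast+
      then show ?thesis by (simp add: f_def)
    qed
    have "has_unique_points f m A" if A: "A \<in> \<A>" for A
    proof -
      define J where "J = {x \<in> X. A \<subseteq> V x}"
      obtain F where F: "F \<subseteq> A" "finite F" "card F = d"
        using infinite_arbitrarily_large[OF infA[OF A]] by blast
      have "F \<subseteq> (\<Union>x\<in>X. V x)" using F(1) AX(1)[OF A] V_self by blast
      moreover have "F \<noteq> {}" using F(3) d by auto
      ultimately have "\<exists>x\<in>X. F \<subseteq> V x"
        by (intro finite_subset_chain_UN[OF wo F(2) _ subset_refl]) (simp_all add: V_mono)
      then obtain x0 where x0: "x0 \<in> X" "F \<subseteq> V x0" by blast
      have "heavy d (V x0) A" using F x0(2) unfolding heavy_def by blast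
      then have x0J: "x0 \<in> J" using sub_V[OF A] x0(1) by (simp add: J_def)
      obtain x where x: "x \<in> J" "\<And>y. (y, x) \<in> r - Id \<Longrightarrow> y \<notin> J"
        using wfE_min[OF r(6) x0J] by metis
      \<comment> \<open>Otherwise \<open>d\<close> points of \<open>A\<close> in \<open>Z x\<close>
        would lie in a single earlier \<open>V y\<close>, and closure of that hull would give
        \<open>A \<subseteq> V y\<close>, against the minimality of \<open>x\<close>.\<close>
      have nh: "\<not> heavy d (Z x) A"
      proof
        assume "heavy d (Z x) A"
        then obtain S where S: "S \<subseteq> A" "S \<subseteq> Z x" "finite S" "card S = d" by (auto simp: heavy_def)
        have "S \<noteq> {}" using S(4) d by auto
        then have "\<exists>y\<in>underS r x. S \<subseteq> V y"
          using S(2) by (intro finite_subset_chain_UN[OF wo S(3) _ underX]) (simp_all add: V_mono Z_def)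
        then obtain y where y: "y \<in> underS r x" "S \<subseteq> V y" by blast
        have "heavy d (V y) A" using S y(2) unfolding heavy_def by blast
        then have "y \<in> J" using sub_V[OF A] y(1) r(5) by (auto simp: J_def underS_def)
        then show False using x(2)[of y] y(1) by (auto simp: underS_def)
      qed
      have xX: "x \<in> X" "A \<subseteq> V x" using x(1) by (auto simp: J_def)
      have "A - Z x \<in> \<B> x" using A xX nh by (auto simp: \<B>_def)
      then have "has_unique_points (g x) (m + d) (A - Z x)" using g xX(1) by simp
      moreover have "f z = g x z" if "z \<in> A - Z x" for z
        using that xX by (intro f) (auto simp: W_def)
      ultimately show ?thesis
        using nh has_unique_points_extend[of "g x" m d A "Z x" f] by (simp add: not_heavy_iff)
    qed
    then show ?thesis by blast
  qed
qed

lemma beth_omega_system_cf_colourable: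
  fixes \<A> :: "'a set set" and K :: "'k set"
  assumes "infinite K" "0 < d" "beth_omega_system K d \<A>"
  shows "\<exists>f :: 'a \<Rightarrow> nat. cf_coloring \<A> f UNIV"
proof -
  have "almost_disjoint d \<A>" "\<And>A. A \<in> \<A> \<Longrightarrow> A \<subseteq> UNIV \<and> |A| =o |K|"
    using assms(3) by (auto simp: beth_omega_system_def almost_disjoint_def)
  then obtain f :: "'a \<Rightarrow> nat" where f: "\<And>A. A \<in> \<A> \<Longrightarrow> has_unique_points f 1 A"
    using unique_points_colouring[OF assms(1,2), of \<A> UNIV 1] by blast
  have "\<exists>\<zeta>. \<exists>!x. x \<in> A \<and> f x = \<zeta>" if "A \<in> \<A>" for A
  proof -
    obtain F where F: "F \<subseteq> A" "finite F" "1 \<le> card F" "\<And>x y. x \<in> F \<Longrightarrow> y \<in> A \<Longrightarrow> f y = f x \<Longrightarrow> y = x"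
      using f[OF \<open>A \<in> \<A>\<close>] by (auto simp: has_unique_points_def)
    then obtain x where "x \<in> F" by fastforce
    then show ?thesis using F(1,4) by (intro exI[of _ "f x"] ex1I[of _ x]) auto
  qed
  then show ?thesis by (auto simp: cf_coloring_def)
qed

section \<open>Systems that need many colours\<close>

lemma beth_ge_card_le: "beth_ge K n X \<Longrightarrow> |K| \<le>o |X|"
proof (induction n arbitrary: X)
  case (Suc n)
  then show ?case
    using card_of_mono1 ordLeq_transitive by (metis beth_ge.simps(2))
qed simp

lemma beth_ge_transfer:
  assumes "beth_ge K n X" "|X| \<le>o |X'|"
  shows "beth_ge K n X'"
  using assms
proof (induction n arbitrary: X X')
  case 0
  then show ?case using ordLeq_transitive by auto
next
  case (Suc n)
  then obtain Y where Y: "Y \<subseteq> X" "beth_ge K n Y" "|Pow Y| \<le>o |X|" by auto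
  obtain f where f: "inj_on f X" "f ` X \<subseteq> X'" using Suc.prems(2) card_of_ordLeq by metis
  have fY: "inj_on f Y" using f(1) Y(1) inj_on_subset by blast
  have "beth_ge K n (f ` Y)"
    using Suc.IH[OF Y(2)] card_of_ordLeqI[OF fY, of "f ` Y"] by auto
  moreover have "|Pow (f ` Y)| \<le>o |X'|"
  proof -
    have "Pow (f ` Y) \<subseteq> (`) f ` Pow Y" by (simp add: image_Pow_surj)
    then have "|Pow (f ` Y)| \<le>o |Pow Y|" by (rule surj_imp_ordLeq)
    then show ?thesis by (rule ordLeq_transitive[OF ordLeq_transitive[OF _ Y(3)] Suc.prems(2)])
  qed
  ultimately show ?case using f(2) Y(1) by (metis beth_ge.simps(2) image_mono subset_trans)
qed

text \<open>Unfolding the top \<open>r\<close> exponentiations yields the tower for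
  \<open>forcing_step\<close>, which spends one level per list entry.\<close>

lemma beth_ge_chain:
  assumes "beth_ge K (m + r) W"
  shows "\<exists>Y. Y r = W \<and> beth_ge K m (Y 0) \<and>
             (\<forall>i<r. Y i \<subseteq> Y (Suc i) \<and> |Pow (Y i)| \<le>o |Y (Suc i)| )"
  using assms
proof (induction r arbitrary: W)
  case 0
  then show ?case by (intro exI[of _ "\<lambda>_. W"]) simp
next
  case (Suc r)
  then obtain V where V: "V \<subseteq> W" "beth_ge K (m + r) V" "|Pow V| \<le>o |W|" by auto
  from Suc.IH[OF V(2)] obtain Y where Y: "Y r = V" "beth_ge K m (Y 0)"
    "\<forall>i<r. Y i \<subseteq> Y (Suc i) \<and> |Pow (Y i)| \<le>o |Y (Suc i)|" by auto
  show ?case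
    using V Y by (intro exI[of _ "Y(Suc r := W)"]) (auto simp: less_Suc_eq)
qed

text \<open>The graph of a function on \<open>D\<close> is coded as a subset of \<open>Y\<close>,
  and that subset by a point of \<open>Y'\<close>.\<close>

lemma function_decoder:
  fixes Y Y' :: "'a set" and D :: "'b set"
  assumes "infinite Y" "|Pow Y| \<le>o |Y'|" "|D| \<le>o |Y|"
  shows "\<exists>g :: 'a \<Rightarrow> 'b \<Rightarrow> nat. \<forall>F. \<exists>a\<in>Y'. \<forall>x\<in>D. g a x = F x"
proof -
  have "|D \<times> (UNIV :: nat set)| \<le>o |Y|"
    using assms by (intro card_of_Times_le card_of_nat_le)
  then obtain c where c: "inj_on c (D \<times> (UNIV :: nat set))" "c ` (D \<times> UNIV) \<subseteq> Y"
    using card_of_ordLeq by metis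
  obtain p where p: "inj_on p (Pow Y)" "p ` Pow Y \<subseteq> Y'"
    using assms(2) card_of_ordLeq by metis
  \<comment> \<open>The value is arbitrary where the decoded set has no pair for \<open>x\<close>;
    on codes of graphs it is the right one.\<close>
  define g where "g a x = (SOME m. c (x, m) \<in> inv_into (Pow Y) p a)" for a x
  have "\<exists>a\<in>Y'. \<forall>x\<in>D. g a x = F x" for F
  proof -
    define G where "G = c ` (\<lambda>x. (x, F x)) ` D"
    have G: "G \<in> Pow Y" using c(2) by (auto simp: G_def)
    have "c (x, m) \<in> G \<longleftrightarrow> m = F x" if "x \<in> D" for x m
      using c(1) that unfolding G_def inj_on_def by auto
    then have "\<forall>x\<in>D. g (p G) x = F x"
      using G p(1) by (simp add: g_def)
    then show ?thesis using G p(2) by blast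
  qed
  then show ?thesis by blast
qed

text \<open>There are \<open>2 ^ n\<close> possible ranges, so more than \<open>2 * n\<close> of the
  \<open>r\<close> colourings share one range \<open>E\<close>. Since \<open>E\<close> has at most
  \<open>n\<close> colours, each colour can be given two of these indices, and a point of that
  colour is chosen at both.\<close>

lemma colour_selection:
  fixes lab :: "nat \<Rightarrow> 'a \<Rightarrow> nat"
  assumes lab: "\<And>i y. i < r \<Longrightarrow> y \<in> Y \<Longrightarrow> lab i y < n" and r: "2 ^ n * (2 * n) < r"
  shows "\<exists>I z. I \<subseteq> {..<r} \<and> (\<forall>i\<in>I. z i \<in> Y) \<and> (\<exists>j<r. (\<lambda>i. lab i (z i)) ` I = lab j ` Y)
     \<and> (\<forall>i\<in>I. \<exists>j\<in>I. j \<noteq> i \<and> lab j (z j) = lab i (z i))"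
proof -
  have "(\<lambda>i. lab i ` Y) \<in> {..<r} \<rightarrow> Pow {..<n}" using lab by auto
  then obtain E where E: "E \<in> Pow {..<n}"
    "r \<le> card ((\<lambda>i. lab i ` Y) -` {E} \<inter> {..<r}) * 2 ^ n"
    using pigeonhole_card[of "\<lambda>i. lab i ` Y" "{..<r}" "Pow {..<n}"] by (auto simp: card_Pow)
  define J where "J = (\<lambda>i. lab i ` Y) -` {E} \<inter> {..<r}"
  have "2 ^ n * (2 * n) < card J * 2 ^ n" using E(2) r unfolding J_def by (rule less_le_trans[rotated])
  then have J: "2 * n < card J" by (simp add: mult.commute)
  have finE: "finite E" "card E \<le> n" using E(1) finite_subset card_mono[of "{..<n}" E] by auto
  \<comment> \<open>The boolean component provides two indices per colour.\<close>
  have "card (E \<times> (UNIV :: bool set)) \<le> card J" using finE J by (simp add: card_cartesian_product)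
  moreover have "finite J" by (simp add: J_def)
  ultimately obtain b where b: "b ` (E \<times> (UNIV :: bool set)) \<subseteq> J" "inj_on b (E \<times> (UNIV :: bool set))"
    using finE(1) inj_on_iff_card_le[of "E \<times> (UNIV :: bool set)" J] by (metis finite_SigmaI finite)
  define I where "I = b ` (E \<times> (UNIV :: bool set))"
  have "\<exists>y\<in>Y. lab i y = e" if "i \<in> J" "e \<in> E" for i e using that by (auto simp: J_def)
  then obtain w where w: "\<And>i e. i \<in> J \<Longrightarrow> e \<in> E \<Longrightarrow> w i e \<in> Y \<and> lab i (w i e) = e" by metis
  define z where "z i = w i (fst (inv_into (E \<times> UNIV) b i))" for i
  have z: "z (b (e, t)) \<in> Y \<and> lab (b (e, t)) (z (b (e, t))) = e" if "e \<in> E" for e t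
  proof -
    have "inv_into (E \<times> UNIV) b (b (e, t)) = (e, t)" using b(2) that by simp
    moreover have "b (e, t) \<in> J" using b(1) that by blast
    ultimately show ?thesis using w that by (simp add: z_def)
  qed
  have "J \<noteq> {}" using J by auto
  then obtain j where "j < r" "lab j ` Y = E" by (auto simp: J_def)
  moreover have "(\<lambda>i. lab i (z i)) ` I = E" using z by (force simp: I_def image_iff)
  moreover have "I \<subseteq> {..<r}" using b(1) by (auto simp: I_def J_def)
  moreover have "\<forall>i\<in>I. z i \<in> Y" using z by (auto simp: I_def)
  moreover have "\<exists>j\<in>I. j \<noteq> i \<and> lab j (z j) = lab i (z i)" if i: "i \<in> I" for i
  proof -
    obtain e t where et: "e \<in> E" "i = b (e, t)" using i by (auto simp: I_def)
    have "b (e, \<not> t) \<noteq> i" using b(2) et unfolding inj_on_def by fastforce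
    moreover have "b (e, \<not> t) \<in> I" using et by (auto simp: I_def)
    ultimately show ?thesis using z et by metis
  qed
  ultimately show ?thesis
    by (intro exI[of _ I] exI[of _ z] conjI exI[of _ j]) auto
qed

text \<open>The entry \<open>h ! i\<close> encodes a function of the earlier entries. Choosing the entries from the last to
  the first, \<open>h ! i\<close> may depend on all later ones, so it can predict a quantity that depends
  on every entry except the \<open>i\<close>-th.\<close>

lemma self_predicting_list:
  fixes Y :: "nat \<Rightarrow> 'a set" and g :: "nat \<Rightarrow> 'a \<Rightarrow> 'a list \<times> 'b \<Rightarrow> 'c"
  assumes g: "\<And>i F. i < r \<Longrightarrow> \<exists>a\<in>Y (Suc i). \<forall>x\<in>lists (Y i) \<times> B. g i a x = F x"
    and mono: "\<And>i. i < r \<Longrightarrow> Y i \<subseteq> Y (Suc i)"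
  shows "\<exists>h. length h = r \<and> set h \<subseteq> Y r \<and>
           (\<forall>i<r. \<forall>y\<in>B. g i (h ! i) (take i h, y) = F i (h[i := c]) y)"
proof -
  \<comment> \<open>Here \<open>t\<close> holds the last \<open>m\<close> entries. Its predictions
    must be right for every admissible beginning \<open>u\<close>, since those entries are chosen
    later.\<close>
  have "m \<le> r \<Longrightarrow> \<exists>t. length t = m \<and> set t \<subseteq> Y r \<and>
      (\<forall>u. length u = r - m \<longrightarrow> set u \<subseteq> Y (r - m) \<longrightarrow> (\<forall>i. r - m \<le> i \<longrightarrow> i < r \<longrightarrow>
         (\<forall>y\<in>B. g i ((u @ t) ! i) (take i (u @ t), y) = F i ((u @ t)[i := c]) y)))" for m
  proof (induction m)
    case 0
    then show ?case by simp
  next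
    case (Suc m)
    define j where "j = r - Suc m"
    have j: "r - m = Suc j" "j < r" using Suc.prems by (auto simp: j_def)
    obtain t where t: "length t = m" "set t \<subseteq> Y r"
      and IH: "\<And>u i y. length u = Suc j \<Longrightarrow> set u \<subseteq> Y (Suc j) \<Longrightarrow> Suc j \<le> i \<Longrightarrow> i < r \<Longrightarrow> y \<in> B \<Longrightarrow>
         g i ((u @ t) ! i) (take i (u @ t), y) = F i ((u @ t)[i := c]) y"
      using Suc.IH Suc.prems j(1) by auto
    \<comment> \<open>Position \<open>j\<close> is overwritten by \<open>c\<close> and the tail
      \<open>t\<close> is fixed, so the function that \<open>a\<close> has to code does not involve
      \<open>a\<close>.\<close>
    obtain a where a: "a \<in> Y (Suc j)"
      "\<And>u y. u \<in> lists (Y j) \<Longrightarrow> y \<in> B \<Longrightarrow> g j a (u, y) = F j (u @ c # t) y"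
      using g[OF j(2), of "\<lambda>(u, y). F j (u @ c # t) y"] by fastforce
    have up: "Y (Suc j) \<subseteq> Y r"
    proof -
      have "Suc j + l \<le> r \<Longrightarrow> Y (Suc j) \<subseteq> Y (Suc j + l)" for l
      proof (induction l)
        case (Suc l)
        then show ?case using mono[of "Suc j + l"] by auto
      qed simp
      from this[of "r - Suc j"] show ?thesis using j by simp
    qed
    show ?case
    proof (intro exI[of _ "a # t"] conjI allI impI ballI)
      show "length (a # t) = Suc m" using t by simp
      show "set (a # t) \<subseteq> Y r" using t a up by auto
      fix u i y assume u: "length u = r - Suc m" "set u \<subseteq> Y (r - Suc m)"
        and i: "r - Suc m \<le> i" "i < r" and y: "y \<in> B"
      show "g i ((u @ a # t) ! i) (take i (u @ a # t), y) = F i ((u @ a # t)[i := c]) y"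
      proof (cases "i = j")
        case True
        then show ?thesis using u y a(2)[of u y] by (simp add: j_def nth_append lists_eq_set list_update_append)
      next
        case False
        then have "Suc j \<le> i" using i by (simp add: j_def)
        moreover have "set (u @ [a]) \<subseteq> Y (Suc j)" using u a(1) mono[OF j(2)] by (auto simp: j_def)
        ultimately show ?thesis using IH[of "u @ [a]" i y] u i y by (simp add: j_def[symmetric])
      qed
    qed
  qed
  from this[of r] obtain t where t: "length t = r" "set t \<subseteq> Y r" "(\<forall>u. length u = 0 \<longrightarrow> set u \<subseteq> Y 0 \<longrightarrow> (\<forall>i. 0 \<le> i \<longrightarrow> i < r \<longrightarrow>
         (\<forall>y\<in>B. g i ((u @ t) ! i) (take i (u @ t), y) = F i ((u @ t)[i := c]) y)))" by auto
  from t(3)[rule_format, of "[]"] t(1,2) show ?thesis by (intro exI[of _ t]) simp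
qed

section \<open>Linear systems and their transport along injections\<close>

definition linear_system :: "'k set \<Rightarrow> 'a set \<Rightarrow> 'a set set \<Rightarrow> bool" where
  "linear_system K W \<S> \<longleftrightarrow> (\<forall>S\<in>\<S>. S \<subseteq> W \<and> |S| =o |K| ) \<and>
     (\<forall>S\<in>\<S>. \<forall>T\<in>\<S>. \<forall>x\<in>S \<inter> T. \<forall>y\<in>S \<inter> T. x \<noteq> y \<longrightarrow> S = T)"

text \<open>Void for \<open>k = 0\<close>; for \<open>k > n\<close> it excludes every conflict free
  colouring of \<open>W\<close> with values below \<open>n\<close>. Counting colours on all of
  \<open>W\<close> makes the bound survive an enlargement of \<open>W\<close>.\<close>

definition forces_colours :: "nat \<Rightarrow> nat \<Rightarrow> 'a set \<Rightarrow> 'a set set \<Rightarrow> bool" where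
  "forces_colours k n W \<S> \<longleftrightarrow>
     (\<forall>f. f ` W \<subseteq> {..<n} \<longrightarrow> cf_coloring \<S> f UNIV \<longrightarrow> k \<le> card (f ` W))"

lemma linear_system_unique:
  assumes "linear_system K W \<S>" "S \<in> \<S>" "T \<in> \<S>" "x \<in> S" "x \<in> T" "y \<in> S" "y \<in> T" "x \<noteq> y"
  shows "S = T"
  using assms unfolding linear_system_def by (metis IntI)

lemma ex1_image_iff:
  assumes "inj_on e S"
  shows "(\<exists>!x. x \<in> e ` S \<and> P x) \<longleftrightarrow> (\<exists>!x. x \<in> S \<and> P (e x))"
proof
  assume "\<exists>!x. x \<in> e ` S \<and> P x"
  then obtain y where y: "y \<in> S" "P (e y)" "\<And>z. z \<in> S \<Longrightarrow> P (e z) \<Longrightarrow> e z = e y" by blast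
  show "\<exists>!x. x \<in> S \<and> P (e x)"
    by (rule ex1I[of _ y]) (use y inj_onD[OF assms] in blast)+
next
  assume "\<exists>!x. x \<in> S \<and> P (e x)"
  then obtain y where y: "y \<in> S" "P (e y)" "\<And>z. z \<in> S \<Longrightarrow> P (e z) \<Longrightarrow> z = y" by blast
  show "\<exists>!x. x \<in> e ` S \<and> P x"
    by (rule ex1I[of _ "e y"]) (use y in blast)+
qed

lemma cf_coloring_image:
  assumes "inj_on e X" "\<And>S. S \<in> \<S> \<Longrightarrow> S \<subseteq> X"
  shows "cf_coloring ((`) e ` \<S>) f UNIV \<longleftrightarrow> cf_coloring \<S> (f \<circ> e) UNIV"
proof -
  have "(\<exists>!x. x \<in> e ` S \<and> f x = \<zeta>) \<longleftrightarrow> (\<exists>!x. x \<in> S \<and> (f \<circ> e) x = \<zeta>)" if "S \<in> \<S>" for S \<zeta>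
  proof -
    have "inj_on e S" using assms that inj_on_subset by blast
    then show ?thesis using ex1_image_iff[of e S "\<lambda>x. f x = \<zeta>"] by simp
  qed
  then show ?thesis by (simp add: cf_coloring_def)
qed

lemma linear_system_image:
  assumes "linear_system K X \<S>" "inj_on e X" "e ` X \<subseteq> W"
  shows "linear_system K W ((`) e ` \<S>)"
proof -
  have sub: "S \<subseteq> X" if "S \<in> \<S>" for S using assms(1) that by (auto simp: linear_system_def)
  have "|e ` S| =o |K|" if "S \<in> \<S>" for S
  proof -
    have "inj_on e S" using sub[OF that] assms(2) inj_on_subset by blast
    then have "|S| =o |e ` S|" by (meson card_of_ordIso inj_on_imp_bij_betw)
    then show ?thesis
      using assms(1) that unfolding linear_system_def
      by (meson ordIso_symmetric ordIso_transitive)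
  qed
  moreover have "S = T" if ST: "S \<in> \<S>" "T \<in> \<S>" "x \<in> e ` S \<inter> e ` T" "y \<in> e ` S \<inter> e ` T" "x \<noteq> y" for S T x y
  proof -
    have "e ` S \<inter> e ` T = e ` (S \<inter> T)"
      using inj_on_image_Int[OF assms(2) sub sub] ST by auto
    then obtain x' y' where "x' \<in> S \<inter> T" "y' \<in> S \<inter> T" "x' \<noteq> y'" using ST(3-5) by auto
    then show ?thesis using assms(1) ST(1,2) unfolding linear_system_def by blast
  qed
  moreover have "e ` S \<subseteq> W" if "S \<in> \<S>" for S using sub[OF that] assms(3) by blast
  ultimately show ?thesis unfolding linear_system_def by blast
qed

lemma forces_colours_image:
  assumes "forces_colours k n X \<S>" "linear_system K X \<S>" "inj_on e X" "e ` X \<subseteq> W"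
  shows "forces_colours k n W ((`) e ` \<S>)"
  unfolding forces_colours_def
proof (intro allI impI)
  fix f assume f: "f ` W \<subseteq> {..<n}" "cf_coloring ((`) e ` \<S>) f UNIV"
  have "cf_coloring \<S> (f \<circ> e) UNIV"
    using cf_coloring_image[OF assms(3)] f(2) assms(2) by (auto simp: linear_system_def)
  moreover have sub: "(f \<circ> e) ` X \<subseteq> f ` W" using assms(4) by auto
  moreover from sub have "(f \<circ> e) ` X \<subseteq> {..<n}" using f(1) by (rule subset_trans)
  ultimately have "k \<le> card ((f \<circ> e) ` X)"
    using assms(1)[unfolded forces_colours_def, rule_format, of "f \<circ> e"] by blast
  also have "\<dots> \<le> card (f ` W)"
    by (rule card_mono[OF finite_subset[OF f(1)] sub]) simp
  finally show "k \<le> card (f ` W)" .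
qed

text \<open>Every position is left unchanged by at least one of the two overwritings.\<close>

lemma list_update_eq_twice:
  assumes "length h = length h'" "h[i := c] = h'[i := c]" "h[j := c] = h'[j := c]" "i \<noteq> j"
  shows "h = h'"
proof (rule nth_equalityI[OF assms(1)])
  fix l assume "l < length h"
  then show "h ! l = h' ! l" using assms by (metis nth_list_update_neq)
qed

text \<open>The points of the new system are triples: \<open>(y, i, l)\<close> with \<open>i < r\<close> lies in the copy of \<open>Y 0\<close> indexed by
  \<open>(i, l)\<close>, and \<open>(q x, r, h)\<close> is a fresh point of the new set \<open>A h\<close>. The position \<open>i\<close> in \<open>h\<close> is deleted
  by overwriting it with \<open>c\<close>; two different deletions determine \<open>h\<close>, which makes the system linear.\<close>

lemma forcing_step:
  fixes Y :: "nat \<Rightarrow> 'a set" and K :: "'k set"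
  assumes K: "infinite K"
    and sys: "linear_system K (Y 0) \<S>" "forces_colours k n (Y 0) \<S>"
    and beth: "|K| \<le>o |Y 0|"
    and mono: "\<And>i. i < r \<Longrightarrow> Y i \<subseteq> Y (Suc i)"
    and pow: "\<And>i. i < r \<Longrightarrow> |Pow (Y i)| \<le>o |Y (Suc i)|"
    and r: "2 ^ n * (2 * n) < r"
  shows "\<exists>\<S>. linear_system K (Y r) \<S> \<and> forces_colours (Suc k) n (Y r) \<S> \<and> |Y r| \<le>o |\<S>|"
proof -
  define W where "W = Y r"
  have mono': "j \<le> r \<Longrightarrow> i \<le> j \<Longrightarrow> Y i \<subseteq> Y j" for i j
  proof (induction j)
    case (Suc j)
    then show ?case using mono[of j] by (cases "i = Suc j") auto
  qed simp
  have infY0: "infinite (Y 0)" using K beth card_of_ordLeq_infinite by blast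
  have inf: "infinite (Y i)" if "i \<le> r" for i using infY0 mono'[OF that, of 0] finite_subset by blast
  have YW: "Y 0 \<subseteq> W" using mono' by (simp add: W_def)
  \<comment> \<open>Taking the overwriting value in \<open>Y 0\<close> keeps the overwritten lists
    in \<open>H\<close>.\<close>
  obtain c where c: "c \<in> Y 0" using infY0 by fastforce
  obtain q where q: "inj_on q K" "q ` K \<subseteq> Y 0" using beth card_of_ordLeq by metis
  have "\<exists>g :: 'a \<Rightarrow> 'a list \<times> 'a \<Rightarrow> nat. \<forall>F. \<exists>a\<in>Y (Suc i). \<forall>x\<in>lists (Y i) \<times> Y 0. g a x = F x"
    if "i < r" for i
  proof (rule function_decoder)
    show "|lists (Y i) \<times> Y 0| \<le>o |Y i|"
      using inf[of i] mono'[of i 0] that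
      by (intro card_of_Times_le card_of_lists_le card_of_mono1) auto
  qed (use inf[of i] pow that in auto)
  then obtain g :: "nat \<Rightarrow> 'a \<Rightarrow> 'a list \<times> 'a \<Rightarrow> nat"
    where g: "\<And>i F. i < r \<Longrightarrow> \<exists>a\<in>Y (Suc i). \<forall>x\<in>lists (Y i) \<times> Y 0. g i a x = F x"
    by metis
  define H where "H = {h. length h = r \<and> set h \<subseteq> W}"
  define lab where "lab h i y = g i (h ! i) (take i h, y)" for h i y
  \<comment> \<open>If some guess of \<open>h\<close> is not below \<open>n\<close>, the empty
    selection will do; thus \<open>A h\<close> makes sense for every \<open>h\<close>.\<close>
  define good where "good h I z \<longleftrightarrow> I \<subseteq> {..<r} \<and> (\<forall>i\<in>I. z i \<in> Y 0) \<and>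
     ((\<forall>i<r. \<forall>y\<in>Y 0. lab h i y < n) \<longrightarrow> (\<exists>j<r. (\<lambda>i. lab h i (z i)) ` I = lab h j ` Y 0)
        \<and> (\<forall>i\<in>I. \<exists>j\<in>I. j \<noteq> i \<and> lab h j (z j) = lab h i (z i)))" for h I z
  have "\<exists>I z. good h I z" for h
  proof (cases "\<forall>i<r. \<forall>y\<in>Y 0. lab h i y < n")
    case True
    then have "\<exists>I z. I \<subseteq> {..<r} \<and> (\<forall>i\<in>I. z i \<in> Y 0)
        \<and> (\<exists>j<r. (\<lambda>i. lab h i (z i)) ` I = lab h j ` Y 0)
        \<and> (\<forall>i\<in>I. \<exists>j\<in>I. j \<noteq> i \<and> lab h j (z j) = lab h i (z i))"
      by (intro colour_selection[OF _ r]) simp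
    then show ?thesis using True by (simp add: good_def)
  next
    case False
    then show ?thesis unfolding good_def by (intro exI[of _ "{}"]) auto
  qed
  then obtain I z where good: "\<And>h. good h (I h) (z h)" by metis
  define A where "A h = (\<lambda>i. (z h i, i, h[i := c])) ` I h \<union> (\<lambda>x. (q x, r, h)) ` K" for h
  define copy where "copy i l S = (\<lambda>y. (y, i, l)) ` S" for i :: nat and l :: "'a list" and S :: "'a set"
  define \<T> where "\<T> = {copy i l S |i l S. i < r \<and> l \<in> H \<and> S \<in> \<S>} \<union> A ` H"
  define X where "X = W \<times> {..r} \<times> lists W"
  have I: "I h \<subseteq> {..<r}" "i \<in> I h \<Longrightarrow> z h i \<in> Y 0" for h i
    using good[of h] by (auto simp: good_def)
  have upd: "h[i := c] \<in> H" if "h \<in> H" for h i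
    using that c YW set_update_subset_insert[of h i c] by (auto simp: H_def)

  have XI: "(y, i, l) \<in> X" if "y \<in> Y 0" "i \<le> r" "l \<in> H" for y i l
    using that YW by (auto simp: X_def H_def lists_eq_set)
  have AX: "A h \<subseteq> X" if "h \<in> H" for h
    unfolding A_def using I(1)[of h] I(2)[of _ h] q(2) that upd by (intro Un_least image_subsetI XI) auto
  have \<S>: "S \<subseteq> Y 0" "|S| =o |K|" if "S \<in> \<S>" for S
    using sys(1) that by (auto simp: linear_system_def)
  have inA: "(\<exists>i<r. i \<in> I h \<and> p = (z h i, i, h[i := c])) \<or> (\<exists>x\<in>K. p = (q x, r, h))"
    if "p \<in> A h" for p h
    using that I(1)[of h] by (auto simp: A_def)
  have copyX: "copy i l S \<subseteq> X" if "i < r" "l \<in> H" "S \<in> \<S>" for i l S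
    unfolding copy_def using that \<S>(1)[of S] by (intro image_subsetI XI) auto

  have linear: "linear_system K X \<T>"
    unfolding linear_system_def
  proof (intro conjI ballI impI)
    fix S assume S: "S \<in> \<T>"
    show "S \<subseteq> X"
      using S unfolding \<T>_def
    proof
      assume "S \<in> A ` H" then show ?thesis using AX by auto
    next
      assume "S \<in> {copy i l S |i l S. i < r \<and> l \<in> H \<and> S \<in> \<S>}"
      then obtain i l S' where "S = copy i l S'" "i < r" "l \<in> H" "S' \<in> \<S>" by auto
      then show ?thesis using copyX by simp
    qed
    show "|S| =o |K|"
    proof (cases "S \<in> A ` H")
      case True
      then obtain h where h: "S = A h" by auto
      have fin: "finite (I h)" using I(1) finite_subset by blast
      have "|(\<lambda>x. (q x, r, h)) ` K| \<le>o |K|" by (rule card_of_image)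
      moreover have "|(\<lambda>i. (z h i, i, h[i := c])) ` I h| \<le>o |K|"
        using fin K by (intro finite_card_of_le_infinite) auto
      ultimately have "|S| \<le>o |K|"
        unfolding h A_def using K by (intro card_of_Un_le)
      moreover have "|K| \<le>o |S|"
        by (rule card_of_ordLeqI[of "\<lambda>x. (q x, r, h)"]) (use q(1) in \<open>auto simp: h A_def inj_on_def\<close>)
      ultimately show ?thesis by (simp add: ordIso_iff_ordLeq)
    next
      case False
      then obtain i l T where T: "T \<in> \<S>" "S = copy i l T" using S by (auto simp: \<T>_def)
      have "bij_betw (\<lambda>y. (y, i, l)) T S" by (auto simp: T copy_def bij_betw_def inj_on_def)
      then have "|S| =o |T|" using card_of_ordIso ordIso_symmetric by blast
      then show ?thesis by (rule ordIso_transitive[OF _ \<S>(2)[OF T(1)]])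
    qed
  next
    fix S T x y assume S: "S \<in> \<T>" and T: "T \<in> \<T>" and x: "x \<in> S \<inter> T" and y: "y \<in> S \<inter> T" and ne: "x \<noteq> y"
    \<comment> \<open>Fresh points carry their list, so for \<open>h \<noteq> h'\<close> common
      points lie in copies, and at position \<open>i\<close> they show that \<open>h\<close> and
      \<open>h'\<close> agree off \<open>i\<close>. Two common points give two positions.\<close>
    have AA: "h = h'" if hh: "h \<in> H" "h' \<in> H" "x \<in> A h \<inter> A h'" "y \<in> A h \<inter> A h'" for h h'
    proof (rule ccontr)
      assume ne': "h \<noteq> h'"
      have "\<exists>i. p = (z h i, i, h[i := c]) \<and> h[i := c] = h'[i := c]" if "p \<in> A h \<inter> A h'" for p
        using inA[of p h] inA[of p h'] that ne' by auto
      then obtain i j where "x = (z h i, i, h[i := c])" "h[i := c] = h'[i := c]"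
         "y = (z h j, j, h[j := c])" "h[j := c] = h'[j := c]"
        using hh(3,4) by metis
      then have "h = h'" using hh(1,2) ne
        by (intro list_update_eq_twice[of h h' i c j]) (auto simp: H_def)
      then show False using ne' by simp
    qed
    \<comment> \<open>\<open>A h\<close> has at most one point at each position below
      \<open>r\<close>, hence at most one in any copy.\<close>
    have AC: False if xy: "i < r" "x \<in> A h" "y \<in> A h" "x \<in> copy i l B" "y \<in> copy i l B" for i l B h
    proof -
      have "p = (z h i, i, h[i := c])" if "p \<in> A h" "p \<in> copy i l B" for p
        using inA[OF that(1)] that(2) \<open>i < r\<close> by (auto simp: copy_def)
      then show False using xy ne by metis
    qed
    show "S = T"
    proof (cases "S \<in> A ` H"; cases "T \<in> A ` H")
      assume "S \<in> A ` H" "T \<in> A ` H"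
      then show ?thesis using AA x y by blast
    next
      assume ST: "S \<in> A ` H" "T \<notin> A ` H"
      then obtain h i l B where "S = A h" "T = copy i l B" "i < r" using T by (auto simp: \<T>_def)
      then show ?thesis using AC[of i h l B] x y by simp
    next
      assume ST: "S \<notin> A ` H" "T \<in> A ` H"
      then obtain h i l B where "T = A h" "S = copy i l B" "i < r" using S by (auto simp: \<T>_def)
      then show ?thesis using AC[of i h l B] x y by simp
    next
      assume "S \<notin> A ` H" "T \<notin> A ` H"
      then obtain i l B i' l' B' where B: "B \<in> \<S>" "S = copy i l B" "B' \<in> \<S>" "T = copy i' l' B'"
        using S T by (auto simp: \<T>_def)
      then have "i = i'" "l = l'" "fst x \<in> B \<inter> B'" "fst y \<in> B \<inter> B'" "fst x \<noteq> fst y"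
        using x y ne by (auto simp: copy_def)
      then show ?thesis using B linear_system_unique[OF sys(1), of B B' "fst x" "fst y"] by simp
    qed
  qed

  have forces: "forces_colours (Suc k) n X \<T>"
    unfolding forces_colours_def
  proof (intro allI impI)
    fix f :: "'a \<times> nat \<times> 'a list \<Rightarrow> nat"
    assume f: "f ` X \<subseteq> {..<n}" "cf_coloring \<T> f UNIV"
    \<comment> \<open>The colours on the \<open>i\<close>-th copy depend on \<open>h\<close> only
      through \<open>h[i := c]\<close>, so some \<open>h\<close> guesses all of its copies
      correctly.\<close>
    have "\<exists>h. length h = r \<and> set h \<subseteq> Y r \<and>
       (\<forall>i<r. \<forall>y\<in>Y 0. g i (h ! i) (take i h, y) = f (y, i, h[i := c]))"
      using self_predicting_list[of r Y "Y 0" g "\<lambda>i l y. f (y, i, l)" c, OF g mono] by simp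
    then obtain h where h: "length h = r" "set h \<subseteq> Y r"
       "\<And>i y. i < r \<Longrightarrow> y \<in> Y 0 \<Longrightarrow> g i (h ! i) (take i h, y) = f (y, i, h[i := c])"
      by auto
    have hH: "h \<in> H" using h by (simp add: H_def W_def)
    have lab: "lab h i y = f (y, i, h[i := c])" if "i < r" "y \<in> Y 0" for i y
      using h(3) that by (simp add: lab_def)
    have mem: "(y, i, h[i := c]) \<in> X" if "i < r" "y \<in> Y 0" for i y
      using that upd[OF hH] by (intro XI) auto
    have fn: "f p < n" if "p \<in> X" for p using f(1) that by auto
    then have "\<forall>i<r. \<forall>y\<in>Y 0. lab h i y < n" using lab mem by simp
    then obtain j where j: "j < r" "(\<lambda>i. lab h i (z h i)) ` I h = lab h j ` Y 0"
      and twice: "\<And>i. i \<in> I h \<Longrightarrow> \<exists>j\<in>I h. j \<noteq> i \<and> lab h j (z h j) = lab h i (z h i)"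
      using good[of h] by (auto simp: good_def)
    define E where "E = lab h j ` Y 0"
    have E: "E = (\<lambda>y. f (y, j, h[j := c])) ` Y 0" using lab j(1) by (auto simp: E_def)
    have "cf_coloring \<S> (\<lambda>y. f (y, j, h[j := c])) UNIV"
    proof -
      have "copy j (h[j := c]) ` \<S> \<subseteq> \<T>"
        using j(1) upd[OF hH] by (auto simp: \<T>_def)
      then have "cf_coloring (copy j (h[j := c]) ` \<S>) f UNIV"
        using f(2) unfolding cf_coloring_def by (metis subsetD subset_UNIV)
      then show ?thesis
        using cf_coloring_image[of "\<lambda>y. (y, j, h[j := c])" UNIV \<S> f]
        by (simp add: copy_def[abs_def] comp_def inj_on_def)
    qed
    moreover have "(\<lambda>y. f (y, j, h[j := c])) ` Y 0 \<subseteq> {..<n}" using fn mem j(1) by auto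
    ultimately have kE: "k \<le> card E"
      using sys(2)[unfolded forces_colours_def, rule_format, of "\<lambda>y. f (y, j, h[j := c])"] E by simp
    obtain \<zeta> p where p: "p \<in> A h" "f p = \<zeta>" "\<And>p'. p' \<in> A h \<Longrightarrow> f p' = \<zeta> \<Longrightarrow> p' = p"
    proof -
      have "A h \<in> \<T>" using hH by (simp add: \<T>_def)
      then have "\<exists>\<zeta>. \<exists>!x. x \<in> A h \<and> f x = \<zeta>" using f(2) by (simp add: cf_coloring_def)
      then show thesis using that by blast
    qed
    \<comment> \<open>Every colour of \<open>E\<close> occurs on \<open>A h\<close> at two different
      positions, so it is not the unique one.\<close>
    have "\<zeta> \<notin> E"
    proof
      assume "\<zeta> \<in> E"
      then have "\<zeta> \<in> (\<lambda>i. lab h i (z h i)) ` I h" using j(2) by (simp add: E_def)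
      then obtain i where i: "i \<in> I h" "lab h i (z h i) = \<zeta>" by blast
      then obtain i' where i': "i' \<in> I h" "i' \<noteq> i" "lab h i' (z h i') = \<zeta>" using twice by blast
      have "f (z h i, i, h[i := c]) = \<zeta>" "f (z h i', i', h[i' := c]) = \<zeta>"
        using i i' I(1)[of h] I(2)[of i h] I(2)[of i' h] lab[of i "z h i"] lab[of i' "z h i'"]
        by auto
      moreover have "(z h i, i, h[i := c]) \<in> A h" "(z h i', i', h[i' := c]) \<in> A h"
        using i i' by (auto simp: A_def)
      ultimately have "(z h i, i, h[i := c]) = (z h i', i', h[i' := c])" using p(3) by metis
      then show False using i'(2) by simp
    qed
    moreover have "insert \<zeta> E \<subseteq> f ` X"
      using AX[OF hH] p(1,2) E mem j(1) by auto
    moreover have "finite (f ` X)" using f(1) finite_subset by blast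
    ultimately show "Suc k \<le> card (f ` X)"
      using kE card_mono[of "f ` X" "insert \<zeta> E"] finite_subset[of E "f ` X"] by simp
  qed

  \<comment> \<open>The fresh points reveal the list, so constant lists already give
    \<open>|W|\<close> different sets.\<close>
  have card: "|W| \<le>o |\<T>|"
  proof (rule card_of_ordLeqI)
    obtain x0 where x0: "x0 \<in> K" using K by fastforce
    have A_inj: "h = h'" if "A h = A h'" for h h'
    proof -
      have "(q x0, r, h) \<in> A h" using x0 by (simp add: A_def)
      then show ?thesis using inA[of "(q x0, r, h)" h'] that by auto
    qed
    show "inj_on (\<lambda>w. A (replicate r w)) W"
    proof (rule inj_onI)
      fix w w' assume "A (replicate r w) = A (replicate r w')"
      from A_inj[OF this] show "w = w'" using r by simp
    qed
  next
    fix w assume "w \<in> W"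
    then show "A (replicate r w) \<in> \<T>" by (auto simp: \<T>_def H_def)
  qed

  \<comment> \<open>There are no more triples than points of \<open>W\<close>, so the system can be
    moved back into \<open>W\<close>.\<close>
  have "|X| \<le>o |W|"
    using inf[of r] unfolding X_def W_def
    by (intro card_of_Times_le card_of_lists_le card_of_nat_le) (auto intro: ordIso_imp_ordLeq card_of_refl)
  then obtain e where e: "inj_on e X" "e ` X \<subseteq> W" using card_of_ordLeq by metis
  have "inj_on ((`) e) \<T>"
  proof (rule inj_onI)
    fix S T assume ST: "S \<in> \<T>" "T \<in> \<T>" "e ` S = e ` T"
    then have "S \<subseteq> X" "T \<subseteq> X" using linear by (simp_all add: linear_system_def)
    then show "S = T" using inj_on_image_eq_iff[OF e(1)] ST(3) by blast
  qed
  then have "|\<T>| \<le>o |(`) e ` \<T>|" by (rule card_of_ordLeqI) auto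
  then have "|W| \<le>o |(`) e ` \<T>|" by (rule ordLeq_transitive[OF card])
  then show ?thesis
    using linear_system_image[OF linear e] forces_colours_image[OF forces linear e] W_def by blast
qed

text \<open>Induction on \<open>k\<close>: forcing 0 colours is free, and each further colour costs
  \<open>Suc (2 ^ n * (2 * n))\<close> exponentiations. The bound on \<open>|\<S>|\<close> comes
  from the last step, hence \<open>Suc k\<close>.\<close>

lemma forcing_system_exists:
  fixes K :: "'k set"
  assumes "infinite K"
  shows "\<exists>m. \<forall>W :: 'a set. beth_ge K m W \<longrightarrow>
           (\<exists>\<S>. linear_system K W \<S> \<and> forces_colours (Suc k) n W \<S> \<and> |W| \<le>o |\<S>| )"
proof -
  have step: "\<exists>m. \<forall>W :: 'a set. beth_ge K m W \<longrightarrow>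
           (\<exists>\<S>. linear_system K W \<S> \<and> forces_colours (Suc k) n W \<S> \<and> |W| \<le>o |\<S>| )"
    if IH: "\<forall>W :: 'a set. beth_ge K m W \<longrightarrow> (\<exists>\<S>. linear_system K W \<S> \<and> forces_colours k n W \<S>)" for k m
  proof (intro exI[of _ "m + Suc (2 ^ n * (2 * n))"] allI impI)
    fix W :: "'a set" assume "beth_ge K (m + Suc (2 ^ n * (2 * n))) W"
    from beth_ge_chain[OF this] obtain Y where Y: "Y (Suc (2 ^ n * (2 * n))) = W" "beth_ge K m (Y 0)"
      "\<And>i. i < Suc (2 ^ n * (2 * n)) \<Longrightarrow> Y i \<subseteq> Y (Suc i)"
      "\<And>i. i < Suc (2 ^ n * (2 * n)) \<Longrightarrow> |Pow (Y i)| \<le>o |Y (Suc i)|" by blast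
    obtain \<S> where \<S>: "linear_system K (Y 0) \<S>" "forces_colours k n (Y 0) \<S>" using IH Y(2) by blast
    show "\<exists>\<S>. linear_system K W \<S> \<and> forces_colours (Suc k) n W \<S> \<and> |W| \<le>o |\<S>|"
      using forcing_step[OF assms \<S> beth_ge_card_le[OF Y(2)] Y(3) Y(4) lessI] Y(1) by simp
  qed
  show ?thesis
  proof (induction k)
    case 0
    show ?case by (rule step[of 0]) (auto simp: linear_system_def forces_colours_def)
  next
    case (Suc k)
    then obtain m where "\<forall>W :: 'a set. beth_ge K m W \<longrightarrow>
           (\<exists>\<S>. linear_system K W \<S> \<and> forces_colours (Suc k) n W \<S> \<and> |W| \<le>o |\<S>| )" by blast
    then show ?case by (intro step[of m]) blast
  qed
qed

section \<open>Families of size exactly beth-omega\<close>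

lemma card_is_beth_omega_exists:
  assumes "\<forall>n. beth_ge K n (UNIV :: 'a set)"
  shows "\<exists>W :: 'a set. card_is_beth_omega K W"
proof -
  \<comment> \<open>Cardinals are well-ordered, so a set of least size above all finite stages
    exists.\<close>
  let ?R = "{r. \<exists>W :: 'a set. r = |W| \<and> (\<forall>n. beth_ge K n W)}"
  obtain r where "r \<in> ?R" "\<forall>r'\<in>?R. r \<le>o r'"
    using exists_minim_Card_order[of ?R] assms card_of_Card_order by blast
  then show ?thesis unfolding card_is_beth_omega_def by blast
qed

text \<open>Serves to pass from the points \<open>W\<close> to the system on them, which lives in
  another type. Minimality speaks of subsets of \<open>W\<close> only, so a competitor
  \<open>Z\<close> is first copied into \<open>W\<close>.\<close>

lemma card_is_beth_omega_cong:
  assumes "card_is_beth_omega K W" "|W| =o |V|"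
  shows "card_is_beth_omega K V"
proof -
  have "|V| \<le>o |Z|" if "Z \<subseteq> V" "\<forall>n. beth_ge K n Z" for Z
  proof -
    have "|Z| \<le>o |W|"
      using assms(2) card_of_mono1[OF that(1)] by (meson ordIso_symmetric ordLeq_ordIso_trans)
    then obtain e where e: "inj_on e Z" "e ` Z \<subseteq> W" using card_of_ordLeq by metis
    have "|Z| \<le>o |e ` Z|" by (rule card_of_ordLeqI[OF e(1)]) auto
    have "beth_ge K n (e ` Z)" for n by (rule beth_ge_transfer[OF spec[OF that(2)] \<open>|Z| \<le>o |e ` Z|\<close>])
    then have "|W| \<le>o |e ` Z|"
      using assms(1) e(2) by (simp add: card_is_beth_omega_def)
    also have "|e ` Z| \<le>o |Z|" by (rule card_of_image)
    finally have "|W| \<le>o |Z|" .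
    then show ?thesis by (rule ordIso_ordLeq_trans[OF ordIso_symmetric[OF assms(2)]])
  qed
  moreover have "beth_ge K n V" for n
    by (rule beth_ge_transfer[OF _ ordIso_imp_ordLeq[OF assms(2)]])
       (use assms(1) in \<open>simp add: card_is_beth_omega_def\<close>)
  ultimately show ?thesis unfolding card_is_beth_omega_def by blast
qed

lemma infinite_two_points:
  assumes "infinite S"
  shows "\<exists>x y. x \<in> S \<and> y \<in> S \<and> x \<noteq> y"
proof -
  obtain x where x: "x \<in> S" using assms by fastforce
  have "infinite (S - {x})" using assms by simp
  then obtain y where "y \<in> S - {x}" using infinite_imp_nonempty by blast
  then show ?thesis using x by blast
qed

text \<open>Two points of a member determine it, so picking such a pair embeds \<open>\<S>\<close>
  into \<open>W \<times> W\<close>.\<close>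

lemma linear_system_card_le:
  assumes "infinite K" "infinite W" "linear_system K W \<S>"
  shows "|\<S>| \<le>o |W|"
proof -
  have "infinite S" if "S \<in> \<S>" for S
    using assms(1,3) card_of_ordIso_finite[of S K] that by (simp add: linear_system_def)
  then have "\<exists>x y. x \<in> S \<and> y \<in> S \<and> x \<noteq> y" if "S \<in> \<S>" for S
    using that infinite_two_points by blast
  then obtain p q where pq: "\<And>S. S \<in> \<S> \<Longrightarrow> p S \<in> S \<and> q S \<in> S \<and> p S \<noteq> q S" by metis
  have "|\<S>| \<le>o |W \<times> W|"
  proof (rule card_of_ordLeqI)
    show "inj_on (\<lambda>S. (p S, q S)) \<S>"
      using pq assms(3) unfolding inj_on_def linear_system_def by (metis IntI prod.inject)
  qed (use pq assms(3) in \<open>auto simp: linear_system_def\<close>)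
  also have "|W \<times> W| \<le>o |W|"
    using assms(2) by (simp add: card_of_Times_same_infinite ordIso_imp_ordLeq)
  finally show ?thesis .
qed

lemma beth_omega_system_not_cf_colourable:
  fixes K :: "'k set"
  assumes "infinite K" "d > 1" "\<forall>n. beth_ge K n (UNIV :: 'a set)"
  shows "\<exists>\<A> :: 'a set set. beth_omega_system K d \<A> \<and>
            \<not> (\<exists>f :: 'a \<Rightarrow> nat. cf_coloring \<A> f {..<n})"
proof -
  obtain W :: "'a set" where W: "card_is_beth_omega K W"
    using card_is_beth_omega_exists[OF assms(3)] by blast
  have infW: "infinite W"
    using W assms(1) beth_ge_card_le card_of_ordLeq_infinite unfolding card_is_beth_omega_def by blast
  obtain \<S> where \<S>: "linear_system K W \<S>" "forces_colours (Suc n) n W \<S>" "|W| \<le>o |\<S>|"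
    using forcing_system_exists[OF assms(1), of n n] W unfolding card_is_beth_omega_def by blast
  have card: "card_is_beth_omega K \<S>"
    using card_is_beth_omega_cong[OF W] linear_system_card_le[OF assms(1) infW \<S>(1)] \<S>(3)
    by (metis ordIso_iff_ordLeq)
  have inf: "infinite S" if "S \<in> \<S>" for S
    using assms(1) \<S>(1) card_of_ordIso_finite[of S K] that by (simp add: linear_system_def)
  have "beth_omega_system K d \<S>"
    unfolding beth_omega_system_def
  proof (intro conjI ballI impI)
    fix S assume S: "S \<in> \<S>"
    then show "|S| =o |K|" using \<S>(1) by (simp add: linear_system_def)
    show "\<exists>x y. x \<in> S \<and> y \<in> S \<and> x \<noteq> y" using infinite_two_points[OF inf[OF S]] .
  next
    fix S T assume ST: "S \<in> \<S>" "T \<in> \<S>" "S \<noteq> T"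
    then have "x = y" if "x \<in> S \<inter> T" "y \<in> S \<inter> T" for x y
      using linear_system_unique[OF \<S>(1), of S T x y] that by auto
    \<comment> \<open>Linearity thus serves every \<open>d > 1\<close> at once.\<close>
    then have "\<exists>x. S \<inter> T \<subseteq> {x}" by (cases "S \<inter> T = {}") blast+
    then obtain x where x: "S \<inter> T \<subseteq> {x}" by blast
    show "finite (S \<inter> T)" using finite_subset[OF x] by simp
    show "card (S \<inter> T) < d" using card_mono[OF _ x] assms(2) by simp
  qed (rule card)
  moreover have "\<not> cf_coloring \<S> f {..<n}" for f :: "'a \<Rightarrow> nat"
  proof
    assume f: "cf_coloring \<S> f {..<n}"
    \<comment> \<open>\<open>forces_colours\<close> wants values below \<open>n\<close> on all of
      \<open>W\<close>, while \<open>f\<close> is controlled only on the union. The default 0 is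
      legal because a point of some member yields \<open>0 < n\<close>.\<close>
    define f' where "f' x = (if x \<in> \<Union>\<S> then f x else 0)" for x
    have "infinite \<S>" using card_of_ordLeq_infinite[OF \<S>(3) infW] .
    then obtain S where S: "S \<in> \<S>" using infinite_imp_nonempty by blast
    moreover obtain x where "x \<in> S" using infinite_imp_nonempty[OF inf[OF S]] by blast
    ultimately have "0 < n" using f by (fastforce simp: cf_coloring_def)
    then have sub: "f' ` W \<subseteq> {..<n}" using f by (auto simp: f'_def cf_coloring_def)
    moreover have "cf_coloring \<S> f' UNIV"
    proof -
      have "(x \<in> S \<and> f' x = \<zeta>) \<longleftrightarrow> (x \<in> S \<and> f x = \<zeta>)" if "S \<in> \<S>" for S x \<zeta>
        using that by (auto simp: f'_def)
      then show ?thesis using f by (simp add: cf_coloring_def)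
    qed
    ultimately have "Suc n \<le> card (f' ` W)" using \<S>(2) unfolding forces_colours_def by blast
    also have "\<dots> \<le> n" using card_mono[OF _ sub] by simp
    finally show False by simp
  qed
  ultimately show ?thesis by blast
qed

text \<open>The supremum is expressed by an upper bound for each single system and the failure of
  every finite bound. The third assumption makes the type of points large enough to hold systems of
  this size.\<close>

theorem theorem6p5:
  fixes K :: "'k set" and d :: nat
  assumes "infinite K" and "d > 1"
    and "\<forall>n. beth_ge K n (UNIV :: 'a set)"
  shows "(\<forall>\<A> :: 'a set set. beth_omega_system K d \<A> \<longrightarrow>
            (\<exists>f :: 'a \<Rightarrow> nat. cf_coloring \<A> f UNIV))
       \<and> (\<forall>n :: nat. \<exists>\<A> :: 'a set set. beth_omega_system K d \<A> \<and>
            \<not> (\<exists>f :: 'a \<Rightarrow> nat. cf_coloring \<A> f {..<n}))"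
  using beth_omega_system_cf_colourable[OF assms(1), of d]
    beth_omega_system_not_cf_colourable[OF assms] assms(2) by auto

end
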